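(* Let $V$ be a $k$-vector space with basis $B$, let $g$ be a graph with vertices labeled by elements of $B$, and let $\ell\in\mathbb{L}V$ be a homogeneous element, i.e. a Lie bracket expression in elements of $V$. Then $$\langle g^*,\ell\rangle=\sum_{\sigma:g\leftrightarrow\ell}\langle g^*,\ell\rangle_\sigma ,$$ where the sum is over all bijections $\sigma:g\leftrightarrow\ell$. If there are no bijections $\sigma$, then $\langle g^*,\ell\rangle=0$.
   Context: "Graph" means a directed, acyclic, connected, nonplanar graph (the underlying undirected graph is a finite tree). $\mathbb{G}V$ is the vector space of graphs with vertices labeled by elements of $V$, modulo multilinearity in the labels; the $B$-labeled graphs up to isomorphism form a basis. The graph product $x\otimes y\mapsto(x\to y)$ is the bilinear map sending a pair of graphs to the sum over all ways of adding one directed edge from a vertex of $x$ to a vertex of $y$. $\mathbb{L}V$ is the free Lie algebra on $V$, and $p_G:\mathbb{L}V\to\mathbb{G}V$ is the linear map sending $v\in V$ to the one-vertex graph labeled $v$, with $p_G([\ell_1,\ell_2])=(p_G(\ell_1)\to p_G(\ell_2))-(p_G(\ell_2)\to p_G(\ell_1))$. The pairing is $\langle\gamma,\ell\rangle=\gamma(p_G(\ell))$ for a functional $\gamma$ on $\mathbb{G}V$. For a $B$-labeled graph $g$, $g^*$ is the dual functional of $g$, so $\langle g^*,\ell\rangle$ is the coefficient of $g$ in the graph polynomial $p_G(\ell)$. A bijection $\sigma:g\leftrightarrow\ell$ is a bijection from the vertices of $g$ to the letter positions of the bracket expression $\ell$ such that $v^*(\sigma(v))\ne0$ for every vertex $v$,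 where $v^*$ is the dual functional on $V$ of the label of $v$ and $\sigma(v)$ also denotes the letter at that position. Its weight is $|\sigma|=\prod_v v^*(\sigma(v))$. The subbrackets of $\ell$ are the bracketed pairs occurring in $\ell$, including $\ell$ itself. For an edge $e$ from vertex $a$ to vertex $b$, $\beta_\sigma(e)$ is the smallest subbracket of $\ell$ containing $\sigma(a)$ and $\sigma(b)$, and $\mathrm{sgn}(\beta_\sigma(e))$ is $+1$ or $-1$ according to whether $\sigma(a)$ is left or right of $\sigma(b)$ in $\ell$. Define $\langle g^*,\ell\rangle_\sigma=|\sigma|\prod_{e}\mathrm{sgn}(\beta_\sigma(e))$ (product over the edges of $g$) if $\beta_\sigma:\mathrm{Edges}(g)\to\mathrm{Subbrackets}(\ell)$ is bijective, and $0$ otherwise.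
   Formalization: The sum is over bijections modulo automorphisms of g; over all bijections it equals |Aut(g)|⟨g*,ℓ⟩. The literal formula fails for g = x→y←x, ℓ = [[x,y],x]: ⟨g*,ℓ⟩ = −1 but the sum is −2. It holds as stated if g has no nontrivial automorphism. *)

theory Defs
  imports
    "HOL-Library.FuncSet"
    "HOL-Library.Poly_Mapping"
    "Graph_Theory.Digraph_Component"
begin

section \<open>Formal linear combinations and quotients\<close>

definition pm_scale :: "'k::field \<Rightarrow> ('a \<Rightarrow>\<^sub>0 'k) \<Rightarrow> ('a \<Rightarrow>\<^sub>0 'k)" where
  "pm_scale c x = Poly_Mapping.map ((*) c) x"

lemma lookup_pm_scale: "Poly_Mapping.lookup (pm_scale c x) a = c * Poly_Mapping.lookup x a"
  by (simp add: pm_scale_def Poly_Mapping.map.rep_eq when_def)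

lemma vector_space_pm_scale: "vector_space (pm_scale :: 'k::field \<Rightarrow> ('a \<Rightarrow>\<^sub>0 'k) \<Rightarrow> _)"
  by unfold_locales
     (auto intro!: poly_mapping_eqI simp: lookup_pm_scale lookup_add algebra_simps)

definition lin_ext :: "('a \<Rightarrow> ('b \<Rightarrow>\<^sub>0 'k)) \<Rightarrow> ('a \<Rightarrow>\<^sub>0 'k::field) \<Rightarrow> ('b \<Rightarrow>\<^sub>0 'k)" where
  "lin_ext f x = (\<Sum>a\<in>Poly_Mapping.keys x. pm_scale (Poly_Mapping.lookup x a) (f a))"

definition bilin_ext ::
  "('a \<Rightarrow> 'b \<Rightarrow> ('c \<Rightarrow>\<^sub>0 'k)) \<Rightarrow> ('a \<Rightarrow>\<^sub>0 'k::field) \<Rightarrow> ('b \<Rightarrow>\<^sub>0 'k) \<Rightarrow> ('c \<Rightarrow>\<^sub>0 'k)" where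
  "bilin_ext f x y = lin_ext (\<lambda>a. lin_ext (f a) y) x"

text \<open>The class of \<^term>\<open>x\<close> in the quotient by the subspace \<^term>\<open>R\<close>.\<close>

definition coset :: "('a \<Rightarrow>\<^sub>0 'k::field) set \<Rightarrow> ('a \<Rightarrow>\<^sub>0 'k) \<Rightarrow> ('a \<Rightarrow>\<^sub>0 'k) set" where
  "coset R x = {y. y - x \<in> R}"


section \<open>Bracket expressions and the free Lie algebra\<close>

datatype 'v bexp = Letter 'v | Bracket "'v bexp" "'v bexp"

definition formal_bracket ::
  "('v bexp \<Rightarrow>\<^sub>0 'k::field) \<Rightarrow> ('v bexp \<Rightarrow>\<^sub>0 'k) \<Rightarrow> ('v bexp \<Rightarrow>\<^sub>0 'k)" where
  "formal_bracket = bilin_ext (\<lambda>a b. Poly_Mapping.single (Bracket a b) 1)"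

text \<open>
  Formal linear combinations of bracket expressions, with \<^const>\<open>formal_bracket\<close>, form the free
  nonassociative algebra on the set of all vectors. The free Lie algebra on the vector space is its
  quotient by the ideal generated by linearity in the letters, $[x,x]$ and the Jacobi identity.
\<close>

inductive_set lie_ideal ::
  "('k::field \<Rightarrow> 'v::ab_group_add \<Rightarrow> 'v) \<Rightarrow> ('v bexp \<Rightarrow>\<^sub>0 'k) set"
  for scale :: "'k::field \<Rightarrow> 'v::ab_group_add \<Rightarrow> 'v" where
  letter_add:
    "Poly_Mapping.single (Letter (u + v)) 1
       - (Poly_Mapping.single (Letter u) 1 + Poly_Mapping.single (Letter v) 1) \<in> lie_ideal scale"
| letter_scale:
    "Poly_Mapping.single (Letter (scale c v)) 1
       - pm_scale c (Poly_Mapping.single (Letter v) 1) \<in> lie_ideal scale"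
| alternating: "formal_bracket x x \<in> lie_ideal scale"
| jacobi:
    "formal_bracket x (formal_bracket y z) + formal_bracket y (formal_bracket z x)
       + formal_bracket z (formal_bracket x y) \<in> lie_ideal scale"
| zero: "0 \<in> lie_ideal scale"
| add: "x \<in> lie_ideal scale \<Longrightarrow> y \<in> lie_ideal scale \<Longrightarrow> x + y \<in> lie_ideal scale"
| scale: "x \<in> lie_ideal scale \<Longrightarrow> pm_scale c x \<in> lie_ideal scale"
| bracket_left: "x \<in> lie_ideal scale \<Longrightarrow> formal_bracket x y \<in> lie_ideal scale"
| bracket_right: "x \<in> lie_ideal scale \<Longrightarrow> formal_bracket y x \<in> lie_ideal scale"

text \<open>The element of the free Lie algebra denoted by a bracket expression.\<close>

definition lie_elt ::
  "('k::field \<Rightarrow> 'v::ab_group_add \<Rightarrow> 'v) \<Rightarrow> 'v bexp \<Rightarrow> ('v bexp \<Rightarrow>\<^sub>0 'k) set" where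
  "lie_elt scale e = coset (lie_ideal scale) (Poly_Mapping.single e 1)"


section \<open>Labeled graphs\<close>

text \<open>
  Graphs only matter up to isomorphism, so vertices are natural numbers. The values of
  \<open>label\<close> outside the vertex set are irrelevant.
\<close>

record 'v lgraph =
  shape :: "nat pair_pre_digraph"
  label :: "nat \<Rightarrow> 'v"

abbreviation vertices :: "'v lgraph \<Rightarrow> nat set" where
  "vertices g \<equiv> pverts (shape g)"

abbreviation edges :: "'v lgraph \<Rightarrow> (nat \<times> nat) set" where
  "edges g \<equiv> parcs (shape g)"

text \<open>
  The underlying undirected graph is a finite tree. The constant \<^const>\<open>tree\<close> only excludes
  directed cycles. In the symmetrization a single edge gives a directed cycle of length two, so
  undirected cycles of length one and two are excluded separately, as loops and antiparallel pairs.
\<close>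

definition is_graph :: "'v lgraph \<Rightarrow> bool" where
  "is_graph g \<longleftrightarrow>
     pair_digraph (shape g) \<and>
     (\<forall>a b. (a, b) \<in> edges g \<longrightarrow> (b, a) \<notin> edges g) \<and>
     Digraph_Component.connected (with_proj (shape g)) \<and>
     \<not> (\<exists>p. pre_digraph.cycle (with_proj (mk_symmetric (with_proj (shape g)))) p \<and> 3 \<le> length p)"

definition graph_iso :: "(nat \<Rightarrow> nat) \<Rightarrow> 'v lgraph \<Rightarrow> 'v lgraph \<Rightarrow> bool" where
  "graph_iso f g h \<longleftrightarrow>
     bij_betw f (vertices g) (vertices h) \<and>
     edges h = map_prod f f ` edges g \<and>
     (\<forall>a\<in>vertices g. label h (f a) = label g a)"

definition automorphisms :: "'v lgraph \<Rightarrow> (nat \<Rightarrow> nat) set" where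
  "automorphisms g = {\<alpha> \<in> extensional (vertices g). graph_iso \<alpha> g g}"

definition relabel :: "'v lgraph \<Rightarrow> nat \<Rightarrow> 'v \<Rightarrow> 'v lgraph" where
  "relabel g a u = g\<lparr>label := (label g)(a := u)\<rparr>"

text \<open>
  The space of labeled graphs is the space of formal linear combinations of graphs modulo
  \<open>graph_null\<close>, that is, up to isomorphism and multilinearity in the labels.
\<close>

definition graph_relations ::
  "('k::field \<Rightarrow> 'v::ab_group_add \<Rightarrow> 'v) \<Rightarrow> ('v lgraph \<Rightarrow>\<^sub>0 'k) set" where
  "graph_relations scale =
     {Poly_Mapping.single g 1 - Poly_Mapping.single h 1 | g h f.
        is_graph g \<and> is_graph h \<and> graph_iso f g h} \<union>
     {Poly_Mapping.single (relabel g a (u + v)) 1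
        - (Poly_Mapping.single (relabel g a u) 1 + Poly_Mapping.single (relabel g a v) 1) | g a u v.
        is_graph g \<and> a \<in> vertices g} \<union>
     {Poly_Mapping.single (relabel g a (scale c u)) 1
        - pm_scale c (Poly_Mapping.single (relabel g a u) 1) | g a c u.
        is_graph g \<and> a \<in> vertices g}"

definition graph_null ::
  "('k::field \<Rightarrow> 'v::ab_group_add \<Rightarrow> 'v) \<Rightarrow> ('v lgraph \<Rightarrow>\<^sub>0 'k) set" where
  "graph_null scale = module.span pm_scale (graph_relations scale)"

definition point :: "'v \<Rightarrow> 'v lgraph" where
  "point u = \<lparr>shape = \<lparr>pverts = {0}, parcs = {}\<rparr>, label = (\<lambda>_. u)\<rparr>"

text \<open>
  The disjoint union of two graphs together with a new edge from \<^term>\<open>a\<close> in the first to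
  \<^term>\<open>b\<close> in the second. The vertex \<open>i\<close> becomes \<open>2 * i\<close> in the first and \<open>2 * i + 1\<close> in the second.
\<close>

definition join :: "'v lgraph \<Rightarrow> 'v lgraph \<Rightarrow> nat \<Rightarrow> nat \<Rightarrow> 'v lgraph" where
  "join g h a b =
     \<lparr>shape =
        \<lparr>pverts = (\<lambda>i. 2 * i) ` vertices g \<union> (\<lambda>i. 2 * i + 1) ` vertices h,
         parcs = map_prod (\<lambda>i. 2 * i) (\<lambda>i. 2 * i) ` edges g \<union>
                 map_prod (\<lambda>i. 2 * i + 1) (\<lambda>i. 2 * i + 1) ` edges h \<union>
                 {(2 * a, 2 * b + 1)}\<rparr>,
      label = (\<lambda>i. if even i then label g (i div 2) else label h (i div 2))\<rparr>"

definition graph_prod ::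
  "('v lgraph \<Rightarrow>\<^sub>0 'k::field) \<Rightarrow> ('v lgraph \<Rightarrow>\<^sub>0 'k) \<Rightarrow> ('v lgraph \<Rightarrow>\<^sub>0 'k)" where
  "graph_prod =
     bilin_ext (\<lambda>g h. \<Sum>a\<in>vertices g. \<Sum>b\<in>vertices h. Poly_Mapping.single (join g h a b) 1)"


section \<open>The pairing\<close>

primrec graph_poly :: "'v bexp \<Rightarrow> ('v lgraph \<Rightarrow>\<^sub>0 'k::field)" where
  "graph_poly (Letter u) = Poly_Mapping.single (point u) 1"
| "graph_poly (Bracket a b) =
     graph_prod (graph_poly a) (graph_poly b) - graph_prod (graph_poly b) (graph_poly a)"

text \<open>
  The map induced on the quotients by the linear extension of \<^const>\<open>graph_poly\<close>: the common
  value at all representatives of a class.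
\<close>

definition p_G ::
  "('k::field \<Rightarrow> 'v::ab_group_add \<Rightarrow> 'v) \<Rightarrow> ('v bexp \<Rightarrow>\<^sub>0 'k) set \<Rightarrow> ('v lgraph \<Rightarrow>\<^sub>0 'k) set" where
  "p_G scale X = the_elem ((\<lambda>x. coset (graph_null scale) (lin_ext graph_poly x)) ` X)"

definition basis_graphs :: "'v set \<Rightarrow> 'v lgraph set" where
  "basis_graphs B = {h. is_graph h \<and> label h ` vertices h \<subseteq> B}"

text \<open>
  The functional dual to \<^term>\<open>g\<close> with respect to the basis of isomorphism classes of
  \<^term>\<open>B\<close>-labeled graphs: expand \<^term>\<open>X\<close> in \<^term>\<open>B\<close>-labeled graphs and collect the
  coefficients of all graphs isomorphic to \<^term>\<open>g\<close>.
\<close>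

definition dual_functional :: "'v set \<Rightarrow> 'v lgraph \<Rightarrow> ('v lgraph \<Rightarrow>\<^sub>0 'k::field) set \<Rightarrow> 'k" where
  "dual_functional B g X =
     (THE c. \<exists>x\<in>X. Poly_Mapping.keys x \<subseteq> basis_graphs B \<and>
        c = (\<Sum>h\<in>{h \<in> Poly_Mapping.keys x. \<exists>f. graph_iso f g h}. Poly_Mapping.lookup x h))"

definition pairing ::
  "('k::field \<Rightarrow> 'v::ab_group_add \<Rightarrow> 'v) \<Rightarrow> (('v lgraph \<Rightarrow>\<^sub>0 'k) set \<Rightarrow> 'k)
     \<Rightarrow> ('v bexp \<Rightarrow>\<^sub>0 'k) set \<Rightarrow> 'k" where
  "pairing scale \<gamma> l = \<gamma> (p_G scale l)"


section \<open>Bijections between a graph and a bracket expression\<close>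

primrec letters :: "'v bexp \<Rightarrow> 'v list" where
  "letters (Letter u) = [u]"
| "letters (Bracket a b) = letters a @ letters b"

text \<open>
  An occurrence of a subbracket is represented by the set of letter positions it contains, which
  determines it. A single letter is not a bracketed pair.
\<close>

primrec subbrackets :: "'v bexp \<Rightarrow> nat set set" where
  "subbrackets (Letter u) = {}"
| "subbrackets (Bracket a b) =
     insert {..<length (letters a) + length (letters b)}
       (subbrackets a \<union> (\<lambda>S. (\<lambda>i. length (letters a) + i) ` S) ` subbrackets b)"

definition bijections ::
  "('k::field \<Rightarrow> 'v::ab_group_add \<Rightarrow> 'v) \<Rightarrow> 'v set \<Rightarrow> 'v lgraph \<Rightarrow> 'v bexp \<Rightarrow> (nat \<Rightarrow> nat) set" where
  "bijections scale B g e =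
     {\<sigma> \<in> extensional (vertices g).
        bij_betw \<sigma> (vertices g) {..<length (letters e)} \<and>
        (\<forall>a\<in>vertices g. module.representation scale B (letters e ! \<sigma> a) (label g a) \<noteq> 0)}"

definition weight ::
  "('k::field \<Rightarrow> 'v::ab_group_add \<Rightarrow> 'v) \<Rightarrow> 'v set \<Rightarrow> 'v lgraph \<Rightarrow> 'v bexp \<Rightarrow> (nat \<Rightarrow> nat) \<Rightarrow> 'k" where
  "weight scale B g e \<sigma> =
     (\<Prod>a\<in>vertices g. module.representation scale B (letters e ! \<sigma> a) (label g a))"

definition beta :: "'v bexp \<Rightarrow> (nat \<Rightarrow> nat) \<Rightarrow> nat \<times> nat \<Rightarrow> nat set" where
  "beta e \<sigma> = (\<lambda>(a, b). LEAST S. S \<in> subbrackets e \<and> \<sigma> a \<in> S \<and> \<sigma> b \<in> S)"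

definition sgn_beta :: "(nat \<Rightarrow> nat) \<Rightarrow> nat \<times> nat \<Rightarrow> 'k::field" where
  "sgn_beta \<sigma> = (\<lambda>(a, b). if \<sigma> a < \<sigma> b then 1 else -1)"

definition pairing_at ::
  "('k::field \<Rightarrow> 'v::ab_group_add \<Rightarrow> 'v) \<Rightarrow> 'v set \<Rightarrow> 'v lgraph \<Rightarrow> 'v bexp \<Rightarrow> (nat \<Rightarrow> nat) \<Rightarrow> 'k" where
  "pairing_at scale B g e \<sigma> =
     (if bij_betw (beta e \<sigma>) (edges g) (subbrackets e)
      then weight scale B g e \<sigma> * (\<Prod>d\<in>edges g. sgn_beta \<sigma> d) else 0)"

text \<open>
  A graph stands for its isomorphism class, so two bijections that differ by an automorphism of the
  labeled graph are the same bijection from the class; each must be counted once. With the labels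
  \<open>x, y, x\<close>, the graph $x \to y \leftarrow x$ has coefficient $-1$ in the graph polynomial of
  $[[x,y],x]$, while two functions \<open>\<sigma>\<close> contribute $-1$ each.
\<close>

definition bijection_equiv ::
  "('k::field \<Rightarrow> 'v::ab_group_add \<Rightarrow> 'v) \<Rightarrow> 'v set \<Rightarrow> 'v lgraph \<Rightarrow> 'v bexp
     \<Rightarrow> ((nat \<Rightarrow> nat) \<times> (nat \<Rightarrow> nat)) set" where
  "bijection_equiv scale B g e =
     {(\<sigma>, \<tau>). \<sigma> \<in> bijections scale B g e \<and> \<tau> \<in> bijections scale B g e \<and>
        (\<exists>\<alpha>\<in>automorphisms g. \<forall>a\<in>vertices g. \<tau> a = \<sigma> (\<alpha> a))}"

definition bijection_classes ::
  "('k::field \<Rightarrow> 'v::ab_group_add \<Rightarrow> 'v) \<Rightarrow> 'v set \<Rightarrow> 'v lgraph \<Rightarrow> 'v bexp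
     \<Rightarrow> (nat \<Rightarrow> nat) set set" where
  "bijection_classes scale B g e = bijections scale B g e // bijection_equiv scale B g e"

definition pairing_at_class ::
  "('k::field \<Rightarrow> 'v::ab_group_add \<Rightarrow> 'v) \<Rightarrow> 'v set \<Rightarrow> 'v lgraph \<Rightarrow> 'v bexp
     \<Rightarrow> (nat \<Rightarrow> nat) set \<Rightarrow> 'k" where
  "pairing_at_class scale B g e C = the_elem (pairing_at scale B g e ` C)"

end

theory Submission
  imports Defs
begin

text \<open>
  Unfolding the recursion for \<^const>\<open>graph_poly\<close>, every subbracket of \<open>e\<close> contributes one edge:
  a position in its left half, a position in its right half, and an orientation, with the sign
  \<open>-1\<close> if the edge points from right to left. Hence the graph polynomial is the signed sum of the
  graphs on the letter positions \<open>{..<n}\<close>, labeled by the letters, whose edge set \<open>T\<close> arises from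
  such choices (\<open>eval_graph_poly\<close>). By induction on \<open>e\<close>, these are the sets \<open>T\<close> of edges for which
  sending an edge to the smallest subbracket around its ends is a bijection onto the subbrackets
  (\<open>bracket_trees_iff\<close>).

  Expanding the letters in the basis, the coefficient of \<open>g\<close> is a sum over all pairs \<open>(T, L)\<close> of such
  an edge set and a labeling \<open>L\<close> of the positions by basis vectors for which the resulting graph is
  isomorphic to \<open>g\<close>; the pair contributes the sign of \<open>T\<close> times the product of the coordinates of the
  letters at the labels. A bijection \<open>\<sigma>\<close> moves the edges and labels of \<open>g\<close> to the positions and so
  gives such a pair (\<open>transport\<close>). Its contribution is $\langle g^*, e\rangle_\sigma$, every pair with
  nonzero contribution arises, and two bijections give the same pair iff they differ by an
  automorphism of \<open>g\<close> (\<open>transport_eq_iff\<close>). So the pairs correspond to the classes of bijections, and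
  each class has as many elements as \<open>g\<close> has automorphisms (\<open>card_fiber\<close>).

  Both sides of the pairing are defined on quotients, so two facts have to be supplied.
  The map \<^const>\<open>graph_poly\<close> sends the Lie ideal into the relations between graphs
  (\<open>lin_ext_graph_poly_lie_ideal\<close>). The main point is the Jacobi identity: the associator of the graph
  product is a difference of two sums over graphs, one symmetric in the last two arguments and one
  symmetric in the first two, and therefore vanishes under antisymmetrization. And the
  functional dual to \<open>g\<close> has an explicit description on all labeled graphs, as a sum over basis
  labelings isomorphic to \<open>g\<close>, which is visibly multilinear in the labels and invariant under
  isomorphism (\<open>coefficient_sum_null\<close>, \<open>dual_functional_coset\<close>). For the first fact, joining two trees by an edge
  has to give a tree again (\<open>is_graph_join\<close>).
\<close>


section \<open>Linear extensions\<close>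

interpretation pm: vector_space "pm_scale :: 'k::field \<Rightarrow> ('a \<Rightarrow>\<^sub>0 'k) \<Rightarrow> ('a \<Rightarrow>\<^sub>0 'k)"
  by (rule vector_space_pm_scale)

lemma linearI:
  assumes "vector_space s" "vector_space t"
    and "\<And>x y. F (x + y) = F x + F y" "\<And>c x. F (s c x) = t c (F x)"
  shows "Vector_Spaces.linear s t F"
  using assms
  by (simp add: Vector_Spaces.linear_def module_hom_def module_hom_axioms_def module_iff_vector_space)

text \<open>
  The linear extension of \<open>f\<close>, for an arbitrary target. With \<^const>\<open>pm_scale\<close> it is \<^const>\<open>lin_ext\<close>, and with
  multiplication in the field it gives functionals on formal linear combinations.
\<close>

definition lincomb ::
  "('k::field \<Rightarrow> 'm::ab_group_add \<Rightarrow> 'm) \<Rightarrow> ('a \<Rightarrow> 'm) \<Rightarrow> ('a \<Rightarrow>\<^sub>0 'k) \<Rightarrow> 'm" where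
  "lincomb s f x = (\<Sum>a\<in>Poly_Mapping.keys x. s (Poly_Mapping.lookup x a) (f a))"

lemma lin_ext_eq_lincomb: "lin_ext f = lincomb pm_scale f"
  by (simp add: fun_eq_iff lin_ext_def lincomb_def)

lemma lincomb_superset:
  assumes "vector_space s" "finite A" "Poly_Mapping.keys x \<subseteq> A"
  shows "lincomb s f x = (\<Sum>a\<in>A. s (Poly_Mapping.lookup x a) (f a))"
proof -
  interpret vector_space s by fact
  show ?thesis
    unfolding lincomb_def using assms(2,3)
    by (intro sum.mono_neutral_left) (auto simp: in_keys_iff)
qed

lemma linear_lincomb:
  assumes "vector_space s"
  shows "Vector_Spaces.linear pm_scale s (lincomb s f)"
proof -
  interpret vector_space s by fact
  have "lincomb s f (x + y) = lincomb s f x + lincomb s f y" for x y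
    using Poly_Mapping.keys_add[of x y]
    by (simp add: lincomb_superset[OF assms, of "Poly_Mapping.keys x \<union> Poly_Mapping.keys y"]
        lookup_add scale_left_distrib sum.distrib)
  moreover have "lincomb s f (pm_scale c x) = s c (lincomb s f x)" for c x
    by (subst (1 2) lincomb_superset[OF assms, of "Poly_Mapping.keys x"])
       (auto simp: lookup_pm_scale scale_sum_right in_keys_iff)
  ultimately show ?thesis
    using assms by (intro linearI vector_space_pm_scale) auto
qed

lemma lincomb_single:
  assumes "vector_space s"
  shows "lincomb s f (Poly_Mapping.single a c) = s c (f a)"
proof -
  interpret vector_space s by fact
  show ?thesis
    by (simp add: lincomb_superset[OF assms, of "{a}"])
qed

lemma sum_singles:
  "(\<Sum>a\<in>Poly_Mapping.keys x. pm_scale (Poly_Mapping.lookup x a) (Poly_Mapping.single a 1)) = x"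
  by (rule poly_mapping_eqI)
     (auto simp: lookup_sum lookup_pm_scale lookup_single when_def in_keys_iff if_distrib sum.delta' cong: if_cong)

text \<open>A linear map sends combinations of elements of \<open>A\<close> into a subspace as soon as it does so on
  the elements of \<open>A\<close>.\<close>

text \<open>
  The main tool for statements about formal linear combinations of graphs: membership in a
  subspace, and equality of linear maps, only have to be checked on single graphs. The set \<open>A\<close> is needed
  because most facts hold only for trees and not for arbitrary labeled graphs.
\<close>

lemma linear_into_subspace:
  assumes "Vector_Spaces.linear pm_scale s F" "module.subspace s N"
    and "Poly_Mapping.keys x \<subseteq> A" "\<And>a. a \<in> A \<Longrightarrow> F (Poly_Mapping.single a 1) \<in> N"
  shows "F x \<in> N"
proof -
  interpret F: Vector_Spaces.linear pm_scale s F by fact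
  have "F x = (\<Sum>a\<in>Poly_Mapping.keys x. s (Poly_Mapping.lookup x a) (F (Poly_Mapping.single a 1)))"
    by (subst sum_singles[of x, symmetric]) (simp only: F.sum F.scale)
  also have "\<dots> \<in> N"
    using assms(3,4)
    by (intro F.vs2.subspace_sum[OF assms(2)] F.vs2.subspace_scale[OF assms(2)]) auto
  finally show ?thesis .
qed

lemma linear_ext:
  assumes "Vector_Spaces.linear pm_scale s F" "Vector_Spaces.linear pm_scale s G"
    and "\<And>a. F (Poly_Mapping.single a 1) = G (Poly_Mapping.single a 1)"
  shows "F x = G x"
proof -
  interpret F: Vector_Spaces.linear pm_scale s F by fact
  interpret G: Vector_Spaces.linear pm_scale s G by fact
  show ?thesis
    by (subst (1 2) sum_singles[of x, symmetric]) (simp only: F.sum F.scale G.sum G.scale assms(3))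
qed

lemmas linear_lin_ext = linear_lincomb[OF vector_space_pm_scale, folded lin_ext_eq_lincomb]

lemma lin_ext_single [simp]: "lin_ext f (Poly_Mapping.single a c) = pm_scale c (f a)"
  by (simp add: lin_ext_eq_lincomb lincomb_single vector_space_pm_scale)

lemma linear_bilin_ext_left: "Vector_Spaces.linear pm_scale pm_scale (\<lambda>x. bilin_ext f x y)"
  unfolding bilin_ext_def by (rule linear_lin_ext)

lemma linear_bilin_ext_right: "Vector_Spaces.linear pm_scale pm_scale (bilin_ext f x)"
proof -
  interpret L: Vector_Spaces.linear pm_scale pm_scale "lin_ext (f a)" for a
    by (rule linear_lin_ext)
  show ?thesis
    by (intro linearI vector_space_pm_scale)
       (simp_all add: bilin_ext_def lin_ext_def[of _ x] L.add L.scale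
        pm.scale_right_distrib sum.distrib pm.scale_sum_right mult.commute)
qed

lemma bilin_ext_single:
  "bilin_ext f (Poly_Mapping.single a c) (Poly_Mapping.single b d) = pm_scale (c * d) (f a b)"
  by (simp add: bilin_ext_def)

lemma keys_pm_scale: "Poly_Mapping.keys (pm_scale c x) \<subseteq> Poly_Mapping.keys x"
  by (auto simp: in_keys_iff lookup_pm_scale)


section \<open>Joining trees by an edge\<close>

definition undirected :: "'v lgraph \<Rightarrow> (nat \<times> nat) set" where
  "undirected g = edges g \<union> (edges g)\<inverse>"

text \<open>
  A cycle as an infinite periodic sequence. Compared with a list of edges this avoids the
  distinguished first vertex and the wrap-around at the end.
\<close>

definition circuit :: "('a \<times> 'a) set \<Rightarrow> nat \<Rightarrow> (nat \<Rightarrow> 'a) \<Rightarrow> bool" where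
  "circuit E n v \<longleftrightarrow>
     3 \<le> n \<and> inj_on v {..<n} \<and> (\<forall>k. v (k + n) = v k) \<and> (\<forall>k. (v k, v (Suc k)) \<in> E)"

lemma parcs_mk_symmetric: "parcs (mk_symmetric (with_proj (shape g))) = undirected g"
  by (auto simp: mk_symmetric_def undirected_def)

lemma pverts_mk_symmetric: "pverts (mk_symmetric (with_proj (shape g))) = vertices g"
  by (auto simp: mk_symmetric_def)

lemma pcas_map_upt:
  "pcas (v m) (map (\<lambda>k. (v k, v (Suc k))) [m..<m + n]) (v (m + n))"
proof (induction n arbitrary: m)
  case (Suc n)
  have "[m..<m + Suc n] = m # [Suc m..<Suc m + n]" by (simp add: upt_conv_Cons del: upt_Suc)
  then show ?case using Suc[of "Suc m"] by simp
qed simp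

lemma pcas_nth:
  assumes "pcas u p w" "k < length p"
  shows "fst (p ! k) = (if k = 0 then u else snd (p ! (k - 1)))"
  using assms
proof (induction p arbitrary: u k)
  case (Cons e p)
  then show ?case by (cases k) (auto simp: nth_Cons')
qed simp

lemma pcas_last: "pcas u p w \<Longrightarrow> p \<noteq> [] \<Longrightarrow> w = snd (last p)"
  by (induction p arbitrary: u) auto

lemma tl_pawalk_verts: "pcas u p w \<Longrightarrow> tl (pawalk_verts u p) = map snd p"
proof (induction p arbitrary: u)
  case (Cons e p)
  then show ?case by (cases p) auto
qed simp

text \<open>
  The arcs of a closed walk determine the sequence of their end points, and conversely a period of the
  sequence gives the list of arcs from each vertex to the next.
\<close>

lemma cycle_iff_circuit:
  assumes wf: "edges g \<subseteq> vertices g \<times> vertices g"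
  shows "(\<exists>p. pre_digraph.cycle (with_proj (mk_symmetric (with_proj (shape g)))) p \<and> 3 \<le> length p) \<longleftrightarrow>
    (\<exists>n v. circuit (undirected g) n v)" (is "?lhs \<longleftrightarrow> ?rhs")
proof
  assume ?lhs
  then obtain p u where p: "3 \<le> length p" "set p \<subseteq> undirected g" "pcas u p u" "distinct (map snd p)"
    by (auto simp: pre_digraph.cycle_def pre_digraph.awalk_def parcs_mk_symmetric pverts_mk_symmetric
        cas_with_proj_eq awalk_verts_with_proj_eq tl_pawalk_verts)
  define n where "n = length p"
  define v where "v k = snd (p ! (k mod n))" for k
  have n: "3 \<le> n" using p n_def by simp
  have step: "(v k, v (Suc k)) \<in> undirected g" for k
  proof -
    have lt: "Suc k mod n < length p" using n by (simp add: n_def[symmetric])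
    have "fst (p ! (Suc k mod n)) = v k"
    proof (cases "Suc k mod n = 0")
      case True
      then have "k mod n = n - 1"
        using n by (metis diff_Suc_1 mod_Suc nat.distinct(1))
      moreover have "u = snd (last p)" using p(1,3) pcas_last by fastforce
      ultimately show ?thesis
        using pcas_nth[OF p(3) lt] True n p(1) by (cases "p = []") (auto simp: v_def n_def last_conv_nth)
    next
      case False
      then have "Suc k mod n = Suc (k mod n)" by (metis mod_Suc)
      then show ?thesis using pcas_nth[OF p(3) lt] False by (simp add: v_def)
    qed
    then have "(v k, v (Suc k)) = p ! (Suc k mod n)" by (simp add: v_def prod_eq_iff)
    then show ?thesis using p(2) nth_mem[OF lt] by (metis subsetD)
  qed
  moreover have "inj_on v {..<n}"
    using p(4) by (auto simp: inj_on_def v_def n_def distinct_conv_nth)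
  ultimately have "circuit (undirected g) n v"
    using n by (auto simp: circuit_def v_def)
  then show ?rhs by blast
next
  assume ?rhs
  then obtain n v where c: "3 \<le> n" "inj_on v {..<n}" "\<And>k. v (k + n) = v k"
    "\<And>k. (v k, v (Suc k)) \<in> undirected g"
    by (auto simp: circuit_def)
  define p where "p = map (\<lambda>k. (v k, v (Suc k))) [0..<n]"
  have v0: "v n = v 0" using c(3)[of 0] by simp
  have "pcas (v 0) p (v 0)" using pcas_map_upt[of v 0 n] v0 by (simp add: p_def)
  moreover have "distinct (map snd p)"
  proof -
    have "distinct (map v [0..<n])" using c(2) by (simp add: distinct_map atLeast0LessThan)
    moreover have "map snd p = map v [Suc 0..<Suc n]"
      unfolding p_def by (simp only: map_Suc_upt[symmetric] map_map o_def snd_conv)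
    moreover have "map v [Suc 0..<Suc n] = rotate1 (map v [0..<n])"
      using v0 c(1) by (simp add: upt_conv_Cons[of 0])
    ultimately show ?thesis by simp
  qed
  moreover have "v 0 \<in> vertices g" using c(4)[of 0] wf by (auto simp: undirected_def)
  moreover have "set p \<subseteq> undirected g" using c(4) by (auto simp: p_def)
  moreover have "length p = n" by (simp add: p_def)
  ultimately show ?lhs using c(1)
    by (intro exI[of _ p])
       (auto simp: pre_digraph.cycle_def pre_digraph.awalk_def parcs_mk_symmetric pverts_mk_symmetric
        cas_with_proj_eq awalk_verts_with_proj_eq tl_pawalk_verts intro!: exI[of _ "v 0"])
qed

lemma rtrancl_on_eq_rtrancl:
  assumes "r \<subseteq> A \<times> A" "u \<in> A"
  shows "(u, v) \<in> rtrancl_on A r \<longleftrightarrow> (u, v) \<in> r\<^sup>*"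
proof
  assume "(u, v) \<in> rtrancl_on A r"
  then show "(u, v) \<in> r\<^sup>*" by (induction rule: rtrancl_on_induct) (auto intro: rtrancl_into_rtrancl)
next
  assume "(u, v) \<in> r\<^sup>*"
  then show "(u, v) \<in> rtrancl_on A r"
    by (induction rule: rtrancl_induct)
       (use assms in \<open>auto intro: rtrancl_on_into_rtrancl_on\<close>)
qed

text \<open>
  The description of trees that the following arguments work with. Loops are excluded by the condition
  on antiparallel edges.
\<close>

lemma is_graph_iff:
  "is_graph g \<longleftrightarrow>
     finite (vertices g) \<and> vertices g \<noteq> {} \<and> edges g \<subseteq> vertices g \<times> vertices g \<and>
     (\<forall>a b. (a, b) \<in> edges g \<longrightarrow> (b, a) \<notin> edges g) \<and>
     (\<forall>a\<in>vertices g. \<forall>b\<in>vertices g. (a, b) \<in> (undirected g)\<^sup>*) \<and>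
     (\<forall>n v. \<not> circuit (undirected g) n v)"
proof (cases "edges g \<subseteq> vertices g \<times> vertices g \<and> (\<forall>a b. (a, b) \<in> edges g \<longrightarrow> (b, a) \<notin> edges g)")
  case True
  then have wf: "undirected g \<subseteq> vertices g \<times> vertices g" by (auto simp: undirected_def)
  have "pair_digraph (shape g) \<longleftrightarrow> finite (vertices g)"
    using True finite_subset[of "edges g" "vertices g \<times> vertices g"]
    by (auto simp: pair_digraph_def pair_fin_digraph_def pair_loopfree_digraph_def
        pair_wf_digraph_def pair_fin_digraph_axioms_def pair_loopfree_digraph_axioms_def)
  moreover have "Digraph_Component.connected (with_proj (shape g)) \<longleftrightarrow>
    vertices g \<noteq> {} \<and> (\<forall>a\<in>vertices g. \<forall>b\<in>vertices g. (a, b) \<in> (undirected g)\<^sup>*)"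
    using rtrancl_on_eq_rtrancl[OF wf]
    by (auto simp: connected_def strongly_connected_def reachable_def
        pverts_mk_symmetric parcs_mk_symmetric)
  ultimately show ?thesis
    using True cycle_iff_circuit[of g] unfolding is_graph_def by blast
next
  case False
  then show ?thesis
    by (auto simp: is_graph_def pair_digraph_def pair_loopfree_digraph_def pair_wf_digraph_def)
qed

lemma is_graph_point: "is_graph (point u)"
  by (auto simp: is_graph_iff point_def undirected_def circuit_def)

lemma circuit_periodic: "circuit E n v \<Longrightarrow> v (k + i * n) = v k"
  by (induction i) (auto simp: circuit_def algebra_simps, metis add.assoc add.commute)

text \<open>A circuit that enters \<open>A\<close> also has to leave it, and going back along the same edge is
  not possible in a circuit of length at least three.\<close>

text \<open>
  A circuit that enters \<open>A\<close> also has to leave it. If only one edge connects \<open>A\<close> with its complement, the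
  circuit runs through it in both directions, so the two ends alternate and its period divides two.
\<close>

lemma circuit_bridge:
  assumes "circuit E n v"
    and "\<And>x y. (x, y) \<in> E \<Longrightarrow> x \<in> A \<Longrightarrow> y \<notin> A \<Longrightarrow> x = a \<and> y = b"
    and "\<And>x y. (x, y) \<in> E \<Longrightarrow> x \<notin> A \<Longrightarrow> y \<in> A \<Longrightarrow> x = b \<and> y = a"
  shows "range v \<subseteq> A \<or> range v \<inter> A = {}"
proof (rule ccontr)
  assume *: "\<not> ?thesis"
  have c: "3 \<le> n" "inj_on v {..<n}" "\<And>k. (v k, v (Suc k)) \<in> E" using assms(1) by (auto simp: circuit_def)
  have cross: "\<exists>k. P (v k) \<and> \<not> P (v (Suc k))" if "P (v i)" "\<not> P (v j)" for P i j
  proof (rule ccontr)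
    assume no: "\<not> ?thesis"
    \<comment> \<open>Without a crossing, the property propagates forward from \<open>i\<close>, and by periodicity \<open>j\<close> lies ahead of \<open>i\<close>.\<close>
    have "P (v (i + m))" for m
      by (induction m) (use no that in auto)
    moreover have "i + (j + i * n - i) = j + i * n" using c(1) by (cases n) auto
    ultimately have "P (v (j + i * n))" by metis
    then show False
      using that(2) circuit_periodic[OF assms(1), of j i] by simp
  qed
  obtain i j where ij: "v i \<in> A" "v j \<notin> A" using * by auto
  obtain k where k: "v k \<in> A" "v (Suc k) \<notin> A" using cross[of "\<lambda>x. x \<in> A"] ij by blast
  obtain l where l: "v l \<notin> A" "v (Suc l) \<in> A" using cross[of "\<lambda>x. x \<notin> A"] ij by blast
  have "v k = a" "v (Suc k) = b" "v l = b" "v (Suc l) = a"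
    using assms(2)[OF c(3) k] assms(3)[OF c(3) l] by auto
  then have eq: "v (Suc k) = v l" "v (Suc l) = v k" by auto
  have mod: "v x = v (x mod n)" for x
    using circuit_periodic[OF assms(1), of "x mod n" "x div n"] by simp
  have inj: "x mod n = y mod n" if "v x = v y" for x y
  proof (rule inj_onD[OF c(2)])
    show "v (x mod n) = v (y mod n)" using that mod[of x] mod[of y] by simp
  qed (use c(1) in auto)
  \<comment> \<open>Both \<open>k + 1\<close> and \<open>l\<close> are times at \<open>b\<close>, and both \<open>l + 1\<close> and \<open>k\<close> are times at \<open>a\<close>.\<close>
  have "(k + 2) mod n = k mod n"
    using inj[OF eq(1)] inj[OF eq(2)] by (metis Suc_eq_plus1 add_2_eq_Suc' mod_Suc_eq)
  then have "n dvd 2" by (metis add_diff_cancel_left' le_add1 mod_eq_dvd_iff_nat)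
  then show False using c(1) by (auto dest: dvd_imp_le)
qed

lemma vertices_join [simp]:
  "vertices (join g h a b) = (\<lambda>i. 2 * i) ` vertices g \<union> (\<lambda>i. 2 * i + 1) ` vertices h"
  by (simp add: join_def)

lemma edges_join [simp]:
  "edges (join g h a b) =
     map_prod (\<lambda>i. 2 * i) (\<lambda>i. 2 * i) ` edges g \<union>
     map_prod (\<lambda>i. 2 * i + 1) (\<lambda>i. 2 * i + 1) ` edges h \<union> {(2 * a, 2 * b + 1)}"
  by (simp add: join_def)

lemma mem_edges_join:
  "(x, y) \<in> edges (join g h a b) \<longleftrightarrow>
     even x \<and> even y \<and> (x div 2, y div 2) \<in> edges g \<or>
     odd x \<and> odd y \<and> (x div 2, y div 2) \<in> edges h \<or> x = 2 * a \<and> y = 2 * b + 1"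
proof -
  have "(x, y) \<in> map_prod (\<lambda>i. 2 * i) (\<lambda>i. 2 * i) ` edges g \<longleftrightarrow>
      even x \<and> even y \<and> (x div 2, y div 2) \<in> edges g"
    by (force simp: image_iff)
  moreover have "(x, y) \<in> map_prod (\<lambda>i. 2 * i + 1) (\<lambda>i. 2 * i + 1) ` edges h \<longleftrightarrow>
      odd x \<and> odd y \<and> (x div 2, y div 2) \<in> edges h"
    by (force simp: image_iff elim!: oddE)
  ultimately show ?thesis unfolding edges_join Un_iff insert_iff empty_iff prod.inject by argo
qed

lemma undirected_join:
  "undirected (join g h a b) =
     map_prod (\<lambda>i. 2 * i) (\<lambda>i. 2 * i) ` undirected g \<union>
     map_prod (\<lambda>i. 2 * i + 1) (\<lambda>i. 2 * i + 1) ` undirected h \<union> {(2 * a, 2 * b + 1), (2 * b + 1, 2 * a)}"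
  by (auto simp: undirected_def)

lemma rtrancl_map_prod:
  assumes "(x, y) \<in> r\<^sup>*" "map_prod f f ` r \<subseteq> s"
  shows "(f x, f y) \<in> s\<^sup>*"
  using assms(1)
  by (induction rule: rtrancl_induct) (use assms(2) in \<open>auto intro: rtrancl_into_rtrancl\<close>)

lemma circuit_inj_image:
  assumes "circuit E n v" "inj f" "\<And>k. v k = f (w k)"
    "\<And>k. (f (w k), f (w (Suc k))) \<in> map_prod f f ` r"
  shows "circuit r n w"
proof -
  have "(w k, w (Suc k)) \<in> r" for k
    using assms(4)[of k] assms(2) by (auto dest: injD)
  moreover have "inj_on w {..<n}" using assms(1,3) by (auto simp: circuit_def inj_on_def)
  moreover have "w (k + n) = w k" for k
    using assms by (auto simp: circuit_def dest: injD)
  ultimately show ?thesis using assms(1) by (auto simp: circuit_def)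
qed

text \<open>
  Every vertex is connected with the new edge. The new edge is a bridge between the even vertices, which
  come from \<open>g\<close>, and the odd vertices, which come from \<open>h\<close>, so a circuit stays in one of the two.
\<close>

lemma is_graph_join:
  assumes "is_graph g" "is_graph h" "a \<in> vertices g" "b \<in> vertices h"
  shows "is_graph (join g h a b)"
proof -
  note G = assms(1)[unfolded is_graph_iff] and H = assms(2)[unfolded is_graph_iff]
  let ?j = "join g h a b"
  have "(x, y) \<in> (undirected ?j)\<^sup>*" if "x \<in> vertices ?j" "y \<in> vertices ?j" for x y
  proof -
    have to_a: "(z, 2 * a) \<in> (undirected ?j)\<^sup>* \<and> (2 * a, z) \<in> (undirected ?j)\<^sup>*" if z: "z \<in> vertices ?j" for z
    proof -
      consider i where "i \<in> vertices g" "z = 2 * i" | i where "i \<in> vertices h" "z = 2 * i + 1"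
        using z unfolding vertices_join by blast
      then show ?thesis
      proof cases
        case 1
        then have "(i, a) \<in> (undirected g)\<^sup>*" "(a, i) \<in> (undirected g)\<^sup>*" using G assms(3) by auto
        then show ?thesis
          using 1 rtrancl_map_prod[of _ _ "undirected g" "\<lambda>i. 2 * i" "undirected ?j"]
          by (auto simp: undirected_join)
      next
        case 2
        then have "(i, b) \<in> (undirected h)\<^sup>*" "(b, i) \<in> (undirected h)\<^sup>*" using H assms(4) by auto
        then have "(z, 2 * b + 1) \<in> (undirected ?j)\<^sup>*" "(2 * b + 1, z) \<in> (undirected ?j)\<^sup>*"
          using 2 rtrancl_map_prod[of _ _ "undirected h" "\<lambda>i. 2 * i + 1" "undirected ?j"]
          by (auto simp: undirected_join)
        moreover have "(2 * b + 1, 2 * a) \<in> undirected ?j" "(2 * a, 2 * b + 1) \<in> undirected ?j"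
          by (auto simp: undirected_join)
        ultimately show ?thesis by (meson converse_rtrancl_into_rtrancl rtrancl_into_rtrancl)
      qed
    qed
    show ?thesis using to_a[OF that(1)] to_a[OF that(2)] by (meson rtrancl_trans)
  qed
  moreover have "\<not> circuit (undirected ?j) n v" for n v
  proof
    assume c: "circuit (undirected ?j) n v"
    have "range v \<subseteq> {i. even i} \<or> range v \<inter> {i. even i} = {}"
      by (rule circuit_bridge[OF c, of _ "2 * a" "2 * b + 1"]) (auto simp: undirected_join)
    moreover have step: "(v k, v (Suc k)) \<in> undirected ?j" for k using c by (simp add: circuit_def)
    ultimately consider "\<And>k. even (v k)" | "\<And>k. odd (v k)" by auto
    then show False
    proof cases
      case 1
      have "circuit (undirected g) n (\<lambda>k. v k div 2)"
      proof (rule circuit_inj_image[OF c, of "\<lambda>i. 2 * i"])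
        show "(2 * (v k div 2), 2 * (v (Suc k) div 2)) \<in> map_prod (\<lambda>i. 2 * i) (\<lambda>i. 2 * i) ` undirected g" for k
          using 1[of k] 1[of "Suc k"] step[of k] by (auto simp: undirected_join)
      qed (use 1 in \<open>auto simp: inj_def\<close>)
      then show False using G by blast
    next
      case 2
      have "circuit (undirected h) n (\<lambda>k. v k div 2)"
      proof (rule circuit_inj_image[OF c, of "\<lambda>i. 2 * i + 1"])
        show "(2 * (v k div 2) + 1, 2 * (v (Suc k) div 2) + 1)
          \<in> map_prod (\<lambda>i. 2 * i + 1) (\<lambda>i. 2 * i + 1) ` undirected h" for k
          using 2[of k] 2[of "Suc k"] step[of k] by (auto simp: undirected_join)
      qed (use 2 in \<open>auto simp: inj_def\<close>)
      then show False using H by blast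
    qed
  qed
  moreover have "(y, x) \<notin> edges ?j" if "(x, y) \<in> edges ?j" for x y
  proof -
    have "(i, j) \<in> edges g \<Longrightarrow> (j, i) \<notin> edges g" "(i, j) \<in> edges h \<Longrightarrow> (j, i) \<notin> edges h" for i j
      using G H by blast+
    then show ?thesis using that unfolding mem_edges_join 
      by (elim disjE; elim conjE; simp add: Suc_double_not_eq_double; presburger?)
  qed
  moreover have "finite (vertices ?j)" "vertices ?j \<noteq> {}" using G H by auto
  moreover have "edges ?j \<subseteq> vertices ?j \<times> vertices ?j" using G H assms(3,4) by auto
  ultimately show ?thesis unfolding is_graph_iff by blast
qed


section \<open>The graph product\<close>

lemma linear_span_into:
  assumes "Vector_Spaces.linear s t F" "module.subspace t N" "\<And>r. r \<in> R \<Longrightarrow> F r \<in> N"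
    and "x \<in> module.span s R"
  shows "F x \<in> N"
proof -
  interpret F: Vector_Spaces.linear s t F by fact
  have "F.vs1.subspace (F -` N)"
    by (rule F.subspace_vimage[OF assms(2)])
  then show ?thesis using F.vs1.span_minimal[of R "F -` N"] assms(3,4) by blast
qed

lemma bilinear_into_subspace:
  assumes "\<And>y. Vector_Spaces.linear pm_scale s (\<lambda>x. F x y)"
    and "\<And>x. Vector_Spaces.linear pm_scale s (F x)"
    and "module.subspace s N"
    and "Poly_Mapping.keys x \<subseteq> A" "Poly_Mapping.keys y \<subseteq> A'"
    and "\<And>a b. a \<in> A \<Longrightarrow> b \<in> A' \<Longrightarrow> F (Poly_Mapping.single a 1) (Poly_Mapping.single b 1) \<in> N"
  shows "F x y \<in> N"
  by (rule linear_into_subspace[OF assms(1,3,4)], rule linear_into_subspace[OF assms(2,3,5)])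
     (rule assms(6))

lemma subspace_keys: "pm.subspace {x. Poly_Mapping.keys x \<subseteq> A}"
  unfolding pm.subspace_def mem_Collect_eq
  by (intro conjI ballI allI impI order_trans[OF Poly_Mapping.keys_add] order_trans[OF keys_pm_scale])
     simp_all

interpretation prod_left: Vector_Spaces.linear pm_scale pm_scale "\<lambda>x. graph_prod x y" for y
  unfolding graph_prod_def by (rule linear_bilin_ext_left)

interpretation prod_right: Vector_Spaces.linear pm_scale pm_scale "graph_prod x" for x
  unfolding graph_prod_def by (rule linear_bilin_ext_right)

interpretation bracket_left: Vector_Spaces.linear pm_scale pm_scale "\<lambda>x. formal_bracket x y" for y
  unfolding formal_bracket_def by (rule linear_bilin_ext_left)

interpretation bracket_right: Vector_Spaces.linear pm_scale pm_scale "formal_bracket x" for x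
  unfolding formal_bracket_def by (rule linear_bilin_ext_right)

interpretation lin_ext: Vector_Spaces.linear pm_scale pm_scale "lin_ext f" for f
  by (rule linear_lin_ext)

lemma graph_prod_single:
  "graph_prod (Poly_Mapping.single g 1) (Poly_Mapping.single h 1) =
     (\<Sum>a\<in>vertices g. \<Sum>b\<in>vertices h. Poly_Mapping.single (join g h a b) 1)"
  by (simp add: graph_prod_def bilin_ext_single)

lemma formal_bracket_single:
  "formal_bracket (Poly_Mapping.single a 1) (Poly_Mapping.single b 1) = Poly_Mapping.single (Bracket a b) 1"
  by (simp add: formal_bracket_def bilin_ext_single)

lemma keys_graph_prod:
  fixes x y :: "'v lgraph \<Rightarrow>\<^sub>0 'k::field"
  assumes "Poly_Mapping.keys x \<subseteq> Collect is_graph" "Poly_Mapping.keys y \<subseteq> Collect is_graph"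
  shows "Poly_Mapping.keys (graph_prod x y) \<subseteq> Collect is_graph"
proof -
  have "graph_prod x y \<in> {x. Poly_Mapping.keys x \<subseteq> Collect is_graph}"
  proof (rule bilinear_into_subspace[OF prod_left.linear_axioms prod_right.linear_axioms subspace_keys assms])
    fix g h :: "'v lgraph" assume "g \<in> Collect is_graph" "h \<in> Collect is_graph"
    then show "graph_prod (Poly_Mapping.single g 1) (Poly_Mapping.single h 1)
        \<in> {x. Poly_Mapping.keys x \<subseteq> Collect is_graph}"
      unfolding graph_prod_single
      by (intro pm.subspace_sum[OF subspace_keys]) (simp add: is_graph_join)
  qed
  then show ?thesis by simp
qed

lemma keys_graph_poly:
  "Poly_Mapping.keys (graph_poly e :: 'v lgraph \<Rightarrow>\<^sub>0 'k::field) \<subseteq> Collect is_graph"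
proof (induction e)
  case (Bracket a b)
  have "graph_poly (Bracket a b) \<in> {x :: 'v lgraph \<Rightarrow>\<^sub>0 'k. Poly_Mapping.keys x \<subseteq> Collect is_graph}"
    unfolding graph_poly.simps using Bracket
    by (intro pm.subspace_diff[OF subspace_keys]) (simp_all add: keys_graph_prod)
  then show ?case by simp
qed (simp add: is_graph_point)

lemma keys_lin_ext_graph_poly:
  "Poly_Mapping.keys (lin_ext graph_poly x) \<subseteq> Collect is_graph"
  using linear_into_subspace[OF linear_lin_ext subspace_keys subset_UNIV, of graph_poly "Collect is_graph" x]
  by (simp add: keys_graph_poly)

lemmas bilinear_simps =
  lin_ext.add lin_ext.scale prod_left.add prod_left.scale prod_right.add prod_right.scale
  bracket_left.add bracket_left.scale bracket_right.add bracket_right.scale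

text \<open>
  The recursion equation for \<^const>\<open>graph_poly\<close>, extended bilinearly.
\<close>

lemma lin_ext_graph_poly_bracket:
  "lin_ext graph_poly (formal_bracket x y) =
     graph_prod (lin_ext graph_poly x) (lin_ext graph_poly y) -
     graph_prod (lin_ext graph_poly y) (lin_ext graph_poly x)" (is "?F x y = ?G x y")
proof -
  have 1: "Vector_Spaces.linear pm_scale pm_scale (\<lambda>x. ?F x y)"
      "Vector_Spaces.linear pm_scale pm_scale (\<lambda>x. ?G x y)" for y
    by (intro linearI vector_space_pm_scale;
        simp only: bilinear_simps add_diff_add pm.scale_right_diff_distrib)+
  have 2: "Vector_Spaces.linear pm_scale pm_scale (\<lambda>y. ?F x y)"
      "Vector_Spaces.linear pm_scale pm_scale (\<lambda>y. ?G x y)" for x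
    by (intro linearI vector_space_pm_scale;
        simp only: bilinear_simps add_diff_add pm.scale_right_diff_distrib)+
  show ?thesis
    by (rule linear_ext[OF 1], rule linear_ext[OF 2]) (simp add: formal_bracket_single)
qed


section \<open>The graph product respects the relations between graphs\<close>

lemma subspace_graph_null: "pm.subspace (graph_null scale)"
  unfolding graph_null_def by (rule pm.subspace_span)

lemma graph_null_relation: "r \<in> graph_relations scale \<Longrightarrow> r \<in> graph_null scale"
  unfolding graph_null_def by (rule pm.span_base)

lemma graph_null_iso:
  "is_graph g \<Longrightarrow> is_graph h \<Longrightarrow> graph_iso f g h \<Longrightarrow>
     Poly_Mapping.single g 1 - Poly_Mapping.single h 1 \<in> graph_null scale"
  by (rule graph_null_relation) (unfold graph_relations_def, blast)

lemma graph_null_add: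
  "is_graph g \<Longrightarrow> a \<in> vertices g \<Longrightarrow>
     Poly_Mapping.single (relabel g a (u + v)) 1
       - (Poly_Mapping.single (relabel g a u) 1 + Poly_Mapping.single (relabel g a v) 1) \<in> graph_null scale"
  by (rule graph_null_relation) (unfold graph_relations_def, blast)

lemma graph_null_scale:
  "is_graph g \<Longrightarrow> a \<in> vertices g \<Longrightarrow>
     Poly_Mapping.single (relabel g a (scale c u)) 1
        - pm_scale c (Poly_Mapping.single (relabel g a u) 1) \<in> graph_null scale"
  by (rule graph_null_relation) (unfold graph_relations_def, blast)

lemma graph_relation_cases [consumes 1, case_names iso add scale]:
  assumes "r \<in> graph_relations scale"
  obtains g h f where "is_graph g" "is_graph h" "graph_iso f g h"
      "r = Poly_Mapping.single g 1 - Poly_Mapping.single h 1"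
  | g a u v where "is_graph g" "a \<in> vertices g"
      "r = Poly_Mapping.single (relabel g a (u + v)) 1
        - (Poly_Mapping.single (relabel g a u) 1 + Poly_Mapping.single (relabel g a v) 1)"
  | g a c u where "is_graph g" "a \<in> vertices g"
      "r = Poly_Mapping.single (relabel g a (scale c u)) 1
        - pm_scale c (Poly_Mapping.single (relabel g a u) 1)"
  using assms unfolding graph_relations_def by blast

lemma vertices_relabel [simp]: "vertices (relabel g a u) = vertices g"
  by (simp add: relabel_def)

lemma is_graph_relabel [simp]: "is_graph (relabel g a u) = is_graph g"
  by (simp add: relabel_def is_graph_def)

text \<open>
  Relabeling commutes with joining, so a product with a multilinearity relation is a sum of
  multilinearity relations.
\<close>

lemma join_relabel_left: "join (relabel g a u) h c d = relabel (join g h c d) (2 * a) u"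
  by (auto simp: join_def relabel_def fun_eq_iff)

lemma join_relabel_right: "join g (relabel h b u) c d = relabel (join g h c d) (2 * b + 1) u"
  by (auto simp: join_def relabel_def fun_eq_iff)

definition join_map :: "(nat \<Rightarrow> nat) \<Rightarrow> (nat \<Rightarrow> nat) \<Rightarrow> nat \<Rightarrow> nat" where
  "join_map f f' i = (if even i then 2 * f (i div 2) else 2 * f' (i div 2) + 1)"

lemma join_map_simps [simp]:
  "join_map f f' (2 * i) = 2 * f i" "join_map f f' (Suc (2 * i)) = Suc (2 * f' i)"
  by (simp_all add: join_map_def)

lemma graph_iso_join:
  assumes "graph_iso f g g'" "graph_iso f' h h'"
  shows "graph_iso (join_map f f') (join g h a b) (join g' h' (f a) (f' b))"
proof -
  have inj: "inj_on f (vertices g)" "inj_on f' (vertices h)"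
    using assms by (auto simp: graph_iso_def bij_betw_def)
  have "inj_on (join_map f f') ((\<lambda>i. 2 * i) ` vertices g)"
    by (rule inj_on_imageI) (use inj(1) in \<open>simp add: inj_on_def\<close>)
  moreover have "inj_on (join_map f f') ((\<lambda>i. 2 * i + 1) ` vertices h)"
    by (rule inj_on_imageI) (use inj(2) in \<open>simp add: inj_on_def\<close>)
  moreover have "join_map f f' ` (\<lambda>i. 2 * i) ` A \<inter> join_map f f' ` (\<lambda>i. 2 * i + 1) ` C = {}" for A C
    by (auto simp: double_not_eq_Suc_double)
  ultimately have "inj_on (join_map f f') (vertices (join g h a b))"
    unfolding vertices_join inj_on_Un by blast
  moreover have "join_map f f' ` vertices (join g h a b) = vertices (join g' h' (f a) (f' b))"
  proof -
    have "vertices g' = f ` vertices g" "vertices h' = f' ` vertices h"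
      using assms by (auto simp: graph_iso_def bij_betw_def)
    then show ?thesis by (simp add: image_Un image_image)
  qed
  moreover have "edges (join g' h' (f a) (f' b)) = map_prod (join_map f f') (join_map f f') ` edges (join g h a b)"
    using assms by (simp add: graph_iso_def image_Un image_image map_prod_def case_prod_beta)
  ultimately show ?thesis
    using assms unfolding graph_iso_def bij_betw_def by (auto simp: join_def)
qed

lemma graph_iso_id: "graph_iso id g g"
  by (simp add: graph_iso_def map_prod.id)

text \<open>
  Multiplying one of the three kinds of relations by a single graph gives a sum of relations of the
  same kind, one for each pair of vertices to be connected. For an isomorphism the summands have to be
  matched along it first. The second factor has to consist of trees, since the relations only concern trees.
\<close>

lemma graph_prod_null_left:
  fixes x y :: "'v::ab_group_add lgraph \<Rightarrow>\<^sub>0 'k::field"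
  assumes "x \<in> graph_null scale" "Poly_Mapping.keys y \<subseteq> Collect is_graph"
  shows "graph_prod x y \<in> graph_null scale"
proof (rule linear_into_subspace[OF prod_right.linear_axioms subspace_graph_null assms(2)])
  fix h :: "'v lgraph" assume "h \<in> Collect is_graph"
  then have h: "is_graph h" by simp
  show "graph_prod x (Poly_Mapping.single h 1) \<in> graph_null scale"
  proof (rule linear_span_into[OF prod_left.linear_axioms subspace_graph_null _ assms(1)[unfolded graph_null_def]])
    fix r assume "r \<in> graph_relations scale"
    then show "graph_prod r (Poly_Mapping.single h 1) \<in> graph_null scale"
    proof (cases rule: graph_relation_cases)
      case (iso g g' f)
      have bij: "bij_betw f (vertices g) (vertices g')" using iso by (simp add: graph_iso_def)
      have *: "graph_prod r (Poly_Mapping.single h 1) =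
        (\<Sum>a\<in>vertices g. \<Sum>b\<in>vertices h.
           Poly_Mapping.single (join g h a b) 1 - Poly_Mapping.single (join g' h (f a) b) 1)"
        unfolding iso prod_left.diff graph_prod_single sum_subtractf
        by (subst sum.reindex_bij_betw[OF bij, symmetric]) simp
      show ?thesis
        unfolding *
      proof (intro pm.subspace_sum[OF subspace_graph_null] graph_null_iso)
        fix a b assume ab: "a \<in> vertices g" "b \<in> vertices h"
        then show "is_graph (join g h a b)" "is_graph (join g' h (f a) b)"
          using iso h bij by (auto intro!: is_graph_join dest: bij_betwE)
        show "graph_iso (join_map f id) (join g h a b) (join g' h (f a) b)"
          using graph_iso_join[OF iso(3) graph_iso_id, of h a b] by simp
      qed
    next
      case (add g a u v)
      show ?thesis
        unfolding add prod_left.diff prod_left.add graph_prod_single sum_subtractf[symmetric]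
          sum.distrib[symmetric] vertices_relabel join_relabel_left
        using add h
        by (intro pm.subspace_sum[OF subspace_graph_null] graph_null_add is_graph_join) auto
    next
      case (scale g a c u)
      show ?thesis
        unfolding scale prod_left.diff prod_left.scale graph_prod_single sum_subtractf[symmetric]
          pm.scale_sum_right vertices_relabel join_relabel_left
        using scale h
        by (intro pm.subspace_sum[OF subspace_graph_null] graph_null_scale is_graph_join) auto
    qed
  qed
qed

text \<open>
  The same argument with the factors exchanged.
\<close>

lemma graph_prod_null_right:
  fixes x y :: "'v::ab_group_add lgraph \<Rightarrow>\<^sub>0 'k::field"
  assumes "x \<in> graph_null scale" "Poly_Mapping.keys y \<subseteq> Collect is_graph"
  shows "graph_prod y x \<in> graph_null scale"
proof (rule linear_into_subspace[OF prod_left.linear_axioms subspace_graph_null assms(2)])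
  fix h :: "'v lgraph" assume "h \<in> Collect is_graph"
  then have h: "is_graph h" by simp
  show "graph_prod (Poly_Mapping.single h 1) x \<in> graph_null scale"
  proof (rule linear_span_into[OF prod_right.linear_axioms subspace_graph_null _ assms(1)[unfolded graph_null_def]])
    fix r assume "r \<in> graph_relations scale"
    then show "graph_prod (Poly_Mapping.single h 1) r \<in> graph_null scale"
    proof (cases rule: graph_relation_cases)
      case (iso g g' f)
      have bij: "bij_betw f (vertices g) (vertices g')" using iso by (simp add: graph_iso_def)
      have *: "graph_prod (Poly_Mapping.single h 1) r =
        (\<Sum>b\<in>vertices h. \<Sum>a\<in>vertices g.
           Poly_Mapping.single (join h g b a) 1 - Poly_Mapping.single (join h g' b (f a)) 1)"
        unfolding iso prod_right.diff graph_prod_single sum_subtractf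
        by (subst sum.reindex_bij_betw[OF bij, symmetric]) simp
      show ?thesis
        unfolding *
      proof (intro pm.subspace_sum[OF subspace_graph_null] graph_null_iso)
        fix b a assume ab: "b \<in> vertices h" "a \<in> vertices g"
        then show "is_graph (join h g b a)" "is_graph (join h g' b (f a))"
          using iso h bij by (auto intro!: is_graph_join dest: bij_betwE)
        show "graph_iso (join_map id f) (join h g b a) (join h g' b (f a))"
          using graph_iso_join[OF graph_iso_id iso(3), of h b a] by simp
      qed
    next
      case (add g a u v)
      show ?thesis
        unfolding add prod_right.diff prod_right.add graph_prod_single sum_subtractf[symmetric]
          sum.distrib[symmetric] vertices_relabel join_relabel_right
        using add h
        by (intro pm.subspace_sum[OF subspace_graph_null] graph_null_add is_graph_join) auto
    next
      case (scale g a c u)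
      show ?thesis
        unfolding scale prod_right.diff prod_right.scale graph_prod_single sum_subtractf[symmetric]
          pm.scale_sum_right vertices_relabel join_relabel_right
        using scale h
        by (intro pm.subspace_sum[OF subspace_graph_null] graph_null_scale is_graph_join) auto
    qed
  qed
qed


section \<open>The Jacobi identity\<close>

lemma graph_isoI:
  assumes "inj f" "vertices h = f ` vertices g" "edges h = map_prod f f ` edges g"
    and "\<And>a. a \<in> vertices g \<Longrightarrow> label h (f a) = label g a"
  shows "graph_iso f g h"
  using assms by (auto simp: graph_iso_def bij_betw_def intro: inj_on_subset)

lemma even_cases4:
  fixes m :: nat
  obtains i where "m = 2 * (2 * i)" | i where "m = 2 * Suc (2 * i)" | i where "m = Suc (2 * i)"
  by (metis Suc_eq_plus1 evenE oddE)

lemma odd_cases4: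
  fixes m :: nat
  obtains i where "m = 2 * i" | i where "m = Suc (2 * (2 * i))" | i where "m = Suc (2 * Suc (2 * i))"
  by (metis Suc_eq_plus1 evenE oddE)

text \<open>
  The following three isomorphisms rearrange nested joins of \<open>x\<close>, \<open>y\<close> and \<open>z\<close>. In
  \<open>join (join x y _ _) z _ _\<close> the vertices of \<open>x\<close>, \<open>y\<close>, \<open>z\<close> have the numbers \<open>4 * i\<close>, \<open>4 * i + 2\<close>, \<open>2 * i + 1\<close>, and
  in \<open>join x (join y z _ _) _ _\<close> they have the numbers \<open>2 * i\<close>, \<open>4 * i + 1\<close>, \<open>4 * i + 3\<close>. The maps \<open>f\<close> translate
  between these numberings.

  Here the edges form a chain from \<open>x\<close> to \<open>y\<close> and from \<open>y\<close> to \<open>z\<close>, which may be built in either order.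
\<close>

lemma chain_iso:
  "\<exists>f. graph_iso f (join (join x y a b) z (2 * c + 1) d) (join x (join y z c d) a (2 * b))"
proof -
  define f :: "nat \<Rightarrow> nat" where
    "f m = (if odd m then 2 * m + 1 else if even (m div 2) then m div 2 else m - 1)" for m
  have f: "f (4 * i) = 2 * i" "f (Suc (Suc (4 * i))) = Suc (4 * i)"
    "f (Suc (2 * i)) = Suc (Suc (Suc (4 * i)))" for i
    by (simp_all add: f_def)
  have "inj f"
  proof (rule injI)
    fix m n assume "f m = f n"
    then show "m = n"
      by (cases m rule: even_cases4; cases n rule: even_cases4)
         (simp_all add: f, presburger+)
  qed
  then have "graph_iso f (join (join x y a b) z (2 * c + 1) d) (join x (join y z c d) a (2 * b))"
    by (rule graph_isoI)
       (auto simp: image_Un image_image map_prod_def case_prod_beta f join_def)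
  then show ?thesis by blast
qed

text \<open>
  Two edges leave \<open>x\<close>, one to \<open>y\<close> and one to \<open>z\<close>, so the roles of \<open>y\<close> and \<open>z\<close> are symmetric.
\<close>

lemma out_fork_iso:
  "\<exists>f. graph_iso f (join (join x y a b) z (2 * c) d) (join (join x z c d) y (2 * a) b)"
proof -
  define f :: "nat \<Rightarrow> nat" where
    "f m = (if odd m then 2 * m else if even (m div 2) then m else m div 2)" for m
  have f: "f (4 * i) = 4 * i" "f (Suc (Suc (4 * i))) = Suc (2 * i)"
    "f (Suc (2 * i)) = Suc (Suc (4 * i))" for i
    by (simp_all add: f_def)
  have "inj f"
  proof (rule injI)
    fix m n assume "f m = f n"
    then show "m = n"
      by (cases m rule: even_cases4; cases n rule: even_cases4)
         (simp_all add: f, presburger+)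
  qed
  then have "graph_iso f (join (join x y a b) z (2 * c) d) (join (join x z c d) y (2 * a) b)"
    by (rule graph_isoI)
       (auto simp: image_Un image_image map_prod_def case_prod_beta f join_def)
  then show ?thesis by blast
qed

text \<open>
  Two edges enter \<open>z\<close>, one from \<open>x\<close> and one from \<open>y\<close>, so the roles of \<open>x\<close> and \<open>y\<close> are symmetric.
\<close>

lemma in_fork_iso:
  "\<exists>f. graph_iso f (join x (join y z b d) a (2 * c + 1)) (join y (join x z a c) b (2 * d + 1))"
proof -
  define f :: "nat \<Rightarrow> nat" where
    "f m = (if even m then 2 * m + 1 else if even (m div 2) then m div 2 else m)" for m
  have f: "f (2 * i) = Suc (4 * i)" "f (Suc (4 * i)) = 2 * i"
    "f (Suc (Suc (Suc (4 * i)))) = Suc (Suc (Suc (4 * i)))" for i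
    by (simp_all add: f_def)
  have "inj f"
  proof (rule injI)
    fix m n assume "f m = f n"
    then show "m = n"
      by (cases m rule: odd_cases4; cases n rule: odd_cases4)
         (simp_all add: f, presburger+)
  qed
  then have "graph_iso f (join x (join y z b d) a (2 * c + 1)) (join y (join x z a c) b (2 * d + 1))"
    by (rule graph_isoI)
       (auto simp: image_Un image_image map_prod_def case_prod_beta f join_def)
  then show ?thesis by blast
qed

lemma sum_vertices_join:
  assumes "is_graph g" "is_graph h"
  shows "(\<Sum>c\<in>vertices (join g h a b). F c) =
    (\<Sum>c\<in>vertices g. F (2 * c)) + (\<Sum>c\<in>vertices h. F (2 * c + 1))"
proof -
  have "finite (vertices g)" "finite (vertices h)" using assms by (auto simp: is_graph_iff)
  then show ?thesis
    unfolding vertices_join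
    by (subst sum.union_disjoint) (auto simp: sum.reindex inj_on_def double_not_eq_Suc_double)
qed

lemma sum_swap_pairs:
  "(\<Sum>a\<in>A. \<Sum>b\<in>B. \<Sum>c\<in>C. \<Sum>d\<in>D. f a b c d) = (\<Sum>c\<in>C. \<Sum>d\<in>D. \<Sum>a\<in>A. \<Sum>b\<in>B. f a b c d)"
proof -
  have "(\<Sum>p\<in>A \<times> B. \<Sum>q\<in>C \<times> D. f (fst p) (snd p) (fst q) (snd q)) =
    (\<Sum>q\<in>C \<times> D. \<Sum>p\<in>A \<times> B. f (fst p) (snd p) (fst q) (snd q))"
    by (rule sum.swap)
  then show ?thesis by (simp add: sum.cartesian_product' )
qed

text \<open>
  The product $(x \to y) \to z$ is the sum of the chains $x \to y \to z$ and of the graphs with two edges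
  leaving \<open>x\<close>; the product $x \to (y \to z)$ is the sum of the same chains and of the graphs with two edges
  entering \<open>z\<close>. Up to isomorphism the chains cancel in the associator, and each of the two remaining sums is
  symmetric in two of the three arguments. In the Jacobi identity, which is the alternating sum of
  the associators over all orders of the arguments, everything cancels.
\<close>

lemma jacobi_single:
  fixes scale :: "'k::field \<Rightarrow> 'v::ab_group_add \<Rightarrow> 'v" and x y z :: "'v lgraph"
  assumes "is_graph x" "is_graph y" "is_graph z"
  defines "X \<equiv> Poly_Mapping.single x (1 :: 'k)" and "Y \<equiv> Poly_Mapping.single y (1 :: 'k)"
    and "Z \<equiv> Poly_Mapping.single z (1 :: 'k)"
  shows "(graph_prod X (graph_prod Y Z - graph_prod Z Y) - graph_prod (graph_prod Y Z - graph_prod Z Y) X)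
       + (graph_prod Y (graph_prod Z X - graph_prod X Z) - graph_prod (graph_prod Z X - graph_prod X Z) Y)
       + (graph_prod Z (graph_prod X Y - graph_prod Y X) - graph_prod (graph_prod X Y - graph_prod Y X) Z)
       \<in> graph_null scale"
proof -
  let ?s = "\<lambda>g. Poly_Mapping.single g (1 :: 'k)"
  define chain where "chain x y z =
    (\<Sum>a\<in>vertices x. \<Sum>b\<in>vertices y. \<Sum>c\<in>vertices y. \<Sum>d\<in>vertices z.
       ?s (join (join x y a b) z (2 * c + 1) d))" for x y z :: "'v lgraph"
  define chain' where "chain' x y z =
    (\<Sum>a\<in>vertices x. \<Sum>b\<in>vertices y. \<Sum>c\<in>vertices y. \<Sum>d\<in>vertices z.
       ?s (join x (join y z c d) a (2 * b)))" for x y z :: "'v lgraph"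
  define out where "out x y z =
    (\<Sum>a\<in>vertices x. \<Sum>b\<in>vertices y. \<Sum>c\<in>vertices x. \<Sum>d\<in>vertices z.
       ?s (join (join x y a b) z (2 * c) d))" for x y z :: "'v lgraph"
  define into where "into x y z =
    (\<Sum>a\<in>vertices x. \<Sum>b\<in>vertices y. \<Sum>c\<in>vertices z. \<Sum>d\<in>vertices z.
       ?s (join x (join y z b d) a (2 * c + 1)))" for x y z :: "'v lgraph"
  have left: "graph_prod (graph_prod (?s x) (?s y)) (?s z) = out x y z + chain x y z"
    if "is_graph x" "is_graph y" for x y z :: "'v lgraph"
    unfolding graph_prod_single prod_left.sum out_def chain_def
    by (simp add: sum_vertices_join that sum.distrib del: vertices_join)
  have right: "graph_prod (?s x) (graph_prod (?s y) (?s z)) = chain' x y z + into x y z"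
    if "is_graph y" "is_graph z" for x y z :: "'v lgraph"
  proof -
    have "graph_prod (?s x) (graph_prod (?s y) (?s z)) =
      (\<Sum>b\<in>vertices y. \<Sum>d\<in>vertices z. \<Sum>a\<in>vertices x.
         (\<Sum>c\<in>vertices y. ?s (join x (join y z b d) a (2 * c))) +
         (\<Sum>c\<in>vertices z. ?s (join x (join y z b d) a (2 * c + 1))))"
      unfolding graph_prod_single prod_right.sum
      by (simp add: sum_vertices_join that del: vertices_join)
    also have "\<dots> = (\<Sum>a\<in>vertices x. \<Sum>b\<in>vertices y. \<Sum>d\<in>vertices z.
         (\<Sum>c\<in>vertices y. ?s (join x (join y z b d) a (2 * c))) +
         (\<Sum>c\<in>vertices z. ?s (join x (join y z b d) a (2 * c + 1))))"
      by (subst (2) sum.swap, subst sum.swap) rule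
    also have "\<dots> = chain' x y z + into x y z"
    proof -
      have "(\<Sum>d\<in>vertices z. \<Sum>c\<in>vertices z. ?s (join x (join y z b d) a (2 * c + 1))) =
        (\<Sum>c\<in>vertices z. \<Sum>d\<in>vertices z. ?s (join x (join y z b d) a (2 * c + 1)))" for a b
        by (rule sum.swap)
      moreover have "(\<Sum>b\<in>vertices y. \<Sum>d\<in>vertices z. \<Sum>c\<in>vertices y. ?s (join x (join y z b d) a (2 * c))) =
        (\<Sum>b\<in>vertices y. \<Sum>c\<in>vertices y. \<Sum>d\<in>vertices z. ?s (join x (join y z c d) a (2 * b)))" for a
        by (subst (2) sum.swap, subst sum.swap) rule
      ultimately show ?thesis by (simp only: sum.distrib chain'_def into_def)
    qed
    finally show ?thesis .
  qed
  have null: "(\<Sum>a\<in>A. \<Sum>b\<in>B. \<Sum>c\<in>C. \<Sum>d\<in>D. ?s (F a b c d) - ?s (F' a b c d)) \<in> graph_null scale"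
    if "\<And>a b c d. a \<in> A \<Longrightarrow> b \<in> B \<Longrightarrow> c \<in> C \<Longrightarrow> d \<in> D \<Longrightarrow>
      is_graph (F a b c d) \<and> is_graph (F' a b c d) \<and> (\<exists>f. graph_iso f (F a b c d) (F' a b c d))"
    for A B C D :: "nat set" and F F' :: "nat \<Rightarrow> nat \<Rightarrow> nat \<Rightarrow> nat \<Rightarrow> 'v lgraph"
    using that by (intro pm.subspace_sum[OF subspace_graph_null]) (meson graph_null_iso)
  have 1: "chain x y z - chain' x y z \<in> graph_null scale"
    if "is_graph x" "is_graph y" "is_graph z" for x y z :: "'v lgraph"
    unfolding chain_def chain'_def sum_subtractf[symmetric]
    using that chain_iso by (intro null) (auto intro!: is_graph_join)
  have 2: "out x y z - out x z y \<in> graph_null scale"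
    if "is_graph x" "is_graph y" "is_graph z" for x y z :: "'v lgraph"
  proof -
    have eq: "out x z y = (\<Sum>a\<in>vertices x. \<Sum>b\<in>vertices y. \<Sum>c\<in>vertices x. \<Sum>d\<in>vertices z.
       ?s (join (join x z c d) y (2 * a) b))"
      unfolding out_def by (rule sum_swap_pairs)
    show ?thesis
      unfolding eq unfolding out_def sum_subtractf[symmetric]
      using that out_fork_iso by (intro null) (auto intro!: is_graph_join)
  qed
  have 3: "into x y z - into y x z \<in> graph_null scale"
    if "is_graph x" "is_graph y" "is_graph z" for x y z :: "'v lgraph"
  proof -
    have eq: "into y x z = (\<Sum>a\<in>vertices x. \<Sum>b\<in>vertices y. \<Sum>c\<in>vertices z. \<Sum>d\<in>vertices z.
       ?s (join y (join x z a c) b (2 * d + 1)))"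
      unfolding into_def
      by (rule trans[OF sum.swap], rule sum.cong[OF refl], rule sum.cong[OF refl], rule sum.swap)
    show ?thesis
      unfolding eq unfolding into_def sum_subtractf[symmetric]
      using that in_fork_iso by (intro null) (auto intro!: is_graph_join)
  qed
  note sub = pm.subspace_add[OF subspace_graph_null] pm.subspace_diff[OF subspace_graph_null]
  \<comment> \<open>Each of the six orders of the arguments gives one difference of chains, and each fork is paired with
    the one obtained by exchanging its two ends.\<close>
  have "(graph_prod X (graph_prod Y Z - graph_prod Z Y) - graph_prod (graph_prod Y Z - graph_prod Z Y) X)
       + (graph_prod Y (graph_prod Z X - graph_prod X Z) - graph_prod (graph_prod Z X - graph_prod X Z) Y)
       + (graph_prod Z (graph_prod X Y - graph_prod Y X) - graph_prod (graph_prod X Y - graph_prod Y X) Z)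
    = (chain x z y - chain' x z y) + (chain y x z - chain' y x z) + (chain z y x - chain' z y x)
    - (chain x y z - chain' x y z) - (chain y z x - chain' y z x) - (chain z x y - chain' z x y)
    + (into x y z - into y x z) + (into y z x - into z y x) + (into z x y - into x z y)
    + (out x z y - out x y z) + (out y x z - out y z x) + (out z y x - out z x y)"
    unfolding X_def Y_def Z_def prod_left.diff prod_right.diff
    by (simp add: left right assms(1-3))
  also have "\<dots> \<in> graph_null scale"
    by (intro sub 1 2 3 assms)
  finally show ?thesis .
qed

definition commutator :: "('v lgraph \<Rightarrow>\<^sub>0 'k::field) \<Rightarrow> ('v lgraph \<Rightarrow>\<^sub>0 'k) \<Rightarrow> ('v lgraph \<Rightarrow>\<^sub>0 'k)" where
  "commutator x y = graph_prod x y - graph_prod y x"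

lemma commutator_bilinear:
  "commutator (x + y) z = commutator x z + commutator y z"
  "commutator z (x + y) = commutator z x + commutator z y"
  "commutator (pm_scale c x) z = pm_scale c (commutator x z)"
  "commutator z (pm_scale c x) = pm_scale c (commutator z x)"
  by (simp_all only: commutator_def bilinear_simps add_diff_add pm.scale_right_diff_distrib)

lemma commutator_jacobi:
  fixes x y z :: "'v::ab_group_add lgraph \<Rightarrow>\<^sub>0 'k::field"
  assumes "Poly_Mapping.keys x \<subseteq> Collect is_graph" "Poly_Mapping.keys y \<subseteq> Collect is_graph"
    "Poly_Mapping.keys z \<subseteq> Collect is_graph"
  shows "commutator x (commutator y z) + commutator y (commutator z x) + commutator z (commutator x y)
    \<in> graph_null scale" (is "?J x y z \<in> _")
proof -
  have lin: "Vector_Spaces.linear pm_scale pm_scale (\<lambda>x. ?J x y z)"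
    "Vector_Spaces.linear pm_scale pm_scale (\<lambda>x. ?J y x z)"
    "Vector_Spaces.linear pm_scale pm_scale (\<lambda>x. ?J y z x)" for y z :: "'v lgraph \<Rightarrow>\<^sub>0 'k"
    by (intro linearI vector_space_pm_scale;
        simp only: commutator_bilinear pm.scale_right_distrib add_ac)+
  show ?thesis
  proof (rule bilinear_into_subspace[OF lin(1,2) subspace_graph_null assms(1,2)])
    fix a b :: "'v lgraph" assume "a \<in> Collect is_graph" "b \<in> Collect is_graph"
    then show "?J (Poly_Mapping.single a 1) (Poly_Mapping.single b 1) z \<in> graph_null scale"
      by (intro linear_into_subspace[OF lin(3) subspace_graph_null assms(3)])
         (simp add: commutator_def jacobi_single)
  qed
qed


section \<open>The map from the free Lie algebra to graphs\<close>

text \<open>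
  The two graphs differ only in the labels outside the vertex set, hence are isomorphic but not
  equal. The right one is of the form for which multilinearity is stated.
\<close>

lemma point_relabel_null:
  "Poly_Mapping.single (point w) 1 - Poly_Mapping.single (relabel (point 0) 0 w) 1 \<in> graph_null scale"
  by (rule graph_null_iso[of _ _ id])
     (auto simp: is_graph_point graph_iso_def map_prod.id, auto simp: point_def relabel_def)

text \<open>
  The letter relations become multilinearity at the only vertex of a point, and the bracket steps hold because
  the relations between graphs absorb products with trees on both sides.
\<close>

lemma lin_ext_graph_poly_lie_ideal:
  fixes scale :: "'k::field \<Rightarrow> 'v::ab_group_add \<Rightarrow> 'v"
  assumes "x \<in> lie_ideal scale"
  shows "lin_ext graph_poly x \<in> graph_null scale"
  using assms
proof (induction rule: lie_ideal.induct)
  case (letter_add u v)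
  have "Poly_Mapping.single (point (u + v)) (1 :: 'k) - (Poly_Mapping.single (point u) 1 + Poly_Mapping.single (point v) 1)
    = (Poly_Mapping.single (point (u + v)) 1 - Poly_Mapping.single (relabel (point 0) 0 (u + v)) 1)
    + (Poly_Mapping.single (relabel (point 0) 0 (u + v)) 1
       - (Poly_Mapping.single (relabel (point 0) 0 u) 1 + Poly_Mapping.single (relabel (point 0) 0 v) 1))
    - (Poly_Mapping.single (point u) 1 - Poly_Mapping.single (relabel (point 0) 0 u) 1)
    - (Poly_Mapping.single (point v) 1 - Poly_Mapping.single (relabel (point 0) 0 v) 1)"
    by (simp add: algebra_simps)
  also have "\<dots> \<in> graph_null scale"
    by (intro pm.subspace_add[OF subspace_graph_null] pm.subspace_diff[OF subspace_graph_null]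
        point_relabel_null graph_null_add is_graph_point)
       (simp add: point_def)
  finally show ?case by (simp add: lin_ext.diff lin_ext.add)
next
  case (letter_scale c v)
  have "Poly_Mapping.single (point (scale c v)) 1 - pm_scale c (Poly_Mapping.single (point v) 1)
    = (Poly_Mapping.single (point (scale c v)) 1 - Poly_Mapping.single (relabel (point 0) 0 (scale c v)) 1)
    + (Poly_Mapping.single (relabel (point 0) 0 (scale c v)) 1
       - pm_scale c (Poly_Mapping.single (relabel (point 0) 0 v) 1))
    - pm_scale c (Poly_Mapping.single (point v) 1 - Poly_Mapping.single (relabel (point 0) 0 v) 1)"
    by (simp add: pm.scale_right_diff_distrib)
  also have "\<dots> \<in> graph_null scale"
    by (intro pm.subspace_add[OF subspace_graph_null] pm.subspace_diff[OF subspace_graph_null]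
        pm.subspace_scale[OF subspace_graph_null] point_relabel_null graph_null_scale is_graph_point)
       (simp add: point_def)
  finally show ?case by (simp add: lin_ext.diff lin_ext.scale)
next
  case (alternating x)
  show ?case by (simp add: lin_ext_graph_poly_bracket pm.subspace_0[OF subspace_graph_null])
next
  case (jacobi x y z)
  show ?case
    using commutator_jacobi[OF keys_lin_ext_graph_poly keys_lin_ext_graph_poly keys_lin_ext_graph_poly]
    by (simp add: lin_ext.add lin_ext_graph_poly_bracket commutator_def)
next
  case (bracket_left x y)
  then show ?case
    unfolding lin_ext_graph_poly_bracket
    by (intro pm.subspace_diff[OF subspace_graph_null] graph_prod_null_left graph_prod_null_right keys_lin_ext_graph_poly)
next
  case (bracket_right x y)
  then show ?case
    unfolding lin_ext_graph_poly_bracket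
    by (intro pm.subspace_diff[OF subspace_graph_null] graph_prod_null_left graph_prod_null_right keys_lin_ext_graph_poly)
qed (simp_all add: lin_ext.add lin_ext.scale pm.subspace_0[OF subspace_graph_null]
      pm.subspace_add[OF subspace_graph_null] pm.subspace_scale[OF subspace_graph_null])

text \<open>
  All representatives of the class have the same image, so the default value of \<^const>\<open>the_elem\<close> does
  not occur.
\<close>

lemma p_G_lie_elt:
  "p_G scale (lie_elt scale e) = coset (graph_null scale) (graph_poly e)"
proof -
  have "coset (graph_null scale) (lin_ext graph_poly x) = coset (graph_null scale) (graph_poly e)"
    if "x \<in> lie_elt scale e" for x
  proof -
    have null: "lin_ext graph_poly x - graph_poly e \<in> graph_null scale"
      using lin_ext_graph_poly_lie_ideal[of "x - Poly_Mapping.single e 1" scale] that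
      by (simp add: lie_elt_def coset_def lin_ext.diff)
    have "y - lin_ext graph_poly x \<in> graph_null scale \<longleftrightarrow> y - graph_poly e \<in> graph_null scale" for y
      using pm.subspace_add[OF subspace_graph_null _ null, of "y - lin_ext graph_poly x"]
        pm.subspace_diff[OF subspace_graph_null _ null, of "y - graph_poly e"]
      by auto
    then show ?thesis by (simp add: coset_def)
  qed
  moreover have "Poly_Mapping.single e 1 \<in> lie_elt scale e"
    by (simp add: lie_elt_def coset_def lie_ideal.zero)
  ultimately have "(\<lambda>x. coset (graph_null scale) (lin_ext graph_poly x)) ` lie_elt scale e
      = {coset (graph_null scale) (graph_poly e)}"
    by blast
  then show ?thesis by (simp add: p_G_def)
qed


section \<open>Isomorphisms and labelings\<close>

text \<open>
  Invertibility of isomorphisms needs this condition: an edge between numbers that are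
  not vertices is not recovered by an inverse of the map on vertices.
\<close>

abbreviation wf_graph :: "'v lgraph \<Rightarrow> bool" where
  "wf_graph g \<equiv> edges g \<subseteq> vertices g \<times> vertices g"

lemma graph_iso_trans:
  assumes "graph_iso f g h" "graph_iso f' h k"
  shows "graph_iso (f' \<circ> f) g k"
  using assms unfolding graph_iso_def
  by (auto simp: map_prod.comp[symmetric] image_comp intro: bij_betw_trans dest: bij_betwE)

lemma graph_iso_sym:
  assumes "graph_iso f g h" "wf_graph g"
  shows "graph_iso (inv_into (vertices g) f) h g"
proof -
  let ?f' = "inv_into (vertices g) f"
  have bij: "bij_betw f (vertices g) (vertices h)" using assms by (simp add: graph_iso_def)
  then have inv: "?f' (f a) = a" if "a \<in> vertices g" for a
    using that by (simp add: bij_betw_inv_into_left)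
  have "map_prod ?f' ?f' ` map_prod f f ` edges g = id ` edges g"
    unfolding image_image using assms(2) by (intro image_cong) (auto simp: inv)
  moreover have "label g (?f' b) = label h b" if "b \<in> vertices h" for b
    using that assms(1) bij bij_betw_inv_into_right[OF bij that] bij_betwE[OF bij_betw_inv_into[OF bij]]
    by (metis graph_iso_def)
  ultimately show ?thesis
    using assms(1) bij_betw_inv_into[OF bij] by (simp add: graph_iso_def)
qed

lemma is_graph_wf: "is_graph g \<Longrightarrow> wf_graph g"
  by (simp add: is_graph_iff)

text \<open>
  The ways to replace the labels of \<open>h\<close> so that the graph becomes isomorphic to \<open>g\<close>. Requiring extensionality
  counts each of them once.
\<close>

definition labelings :: "'v lgraph \<Rightarrow> 'v lgraph \<Rightarrow> (nat \<Rightarrow> 'v) set" where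
  "labelings g h = {L \<in> extensional (vertices h). \<exists>f. graph_iso f g (h\<lparr>label := L\<rparr>)}"

lemma finite_labelings:
  assumes "finite (vertices g)"
  shows "finite (labelings g h)"
proof (cases "labelings g h = {}")
  case False
  then obtain f L where "graph_iso f g (h\<lparr>label := L\<rparr>)" by (auto simp: labelings_def)
  then have "bij_betw f (vertices g) (vertices h)" by (simp add: graph_iso_def)
  then have fin: "finite (vertices h)" using assms bij_betw_finite by blast
  have "labelings g h \<subseteq> vertices h \<rightarrow>\<^sub>E label g ` vertices g"
  proof
    fix L assume "L \<in> labelings g h"
    then obtain f where L: "L \<in> extensional (vertices h)" and f: "graph_iso f g (h\<lparr>label := L\<rparr>)"
      by (auto simp: labelings_def)
    then have "vertices h = f ` vertices g" "\<forall>a\<in>vertices g. L (f a) = label g a"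
      by (auto simp: graph_iso_def bij_betw_def)
    with L show "L \<in> vertices h \<rightarrow>\<^sub>E label g ` vertices g"
      by (auto simp: PiE_iff)
  qed
  then show ?thesis
    using finite_PiE[OF fin, of "\<lambda>_. label g ` vertices g"] assms finite_subset by blast
qed simp


section \<open>The functional dual to a graph\<close>

lemma vector_space_field: "vector_space ((*) :: 'k::field \<Rightarrow> 'k \<Rightarrow> 'k)"
  by unfold_locales (simp_all add: algebra_simps)

interpretation eval: Vector_Spaces.linear pm_scale "(*)" "lincomb (*) f" for f :: "'a \<Rightarrow> 'k::field"
  by (rule linear_lincomb[OF vector_space_field])

lemma eval_single: "lincomb (*) f (Poly_Mapping.single a c) = c * f a"
  by (rule lincomb_single[OF vector_space_field])

locale based_space = vector_space scale
  for scale :: "'k::field \<Rightarrow> 'v::ab_group_add \<Rightarrow> 'v" +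
  fixes B :: "'v set"
  assumes independent_basis: "\<not> dependent B" and span_basis: "span B = UNIV"
begin

text \<open>
  The coefficient of \<open>g\<close> after expanding all labels of \<open>h\<close> in the basis. Defining it by
  this formula on arbitrary graphs, instead of through a choice of expansions, makes its compatibility with
  the relations a direct computation.
\<close>

definition coefficient :: "'v lgraph \<Rightarrow> 'v lgraph \<Rightarrow> 'k" where
  "coefficient g h = (\<Sum>L\<in>labelings g h. \<Prod>a\<in>vertices h. representation B (label h a) (L a))"

lemma coefficient_iso:
  assumes iso: "graph_iso f h h'" and wf: "wf_graph h"
  shows "coefficient g h = coefficient g h'"
proof -
  have bij: "bij_betw f (vertices h) (vertices h')" using iso by (simp add: graph_iso_def)
  let ?f' = "inv_into (vertices h) f"
  note bij' = bij_betw_inv_into[OF bij]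
  have inv: "\<And>a. a \<in> vertices h \<Longrightarrow> ?f' (f a) = a" "\<And>b. b \<in> vertices h' \<Longrightarrow> f (?f' b) = b"
    "\<And>a. a \<in> vertices h \<Longrightarrow> f a \<in> vertices h'" "\<And>b. b \<in> vertices h' \<Longrightarrow> ?f' b \<in> vertices h"
    using bij bij' by (auto simp: bij_betw_inv_into_left bij_betw_inv_into_right dest: bij_betwE)
  let ?i = "\<lambda>L. restrict (L \<circ> ?f') (vertices h')" and ?j = "\<lambda>L. restrict (L \<circ> f) (vertices h)"
  have iso1: "graph_iso f (h\<lparr>label := L\<rparr>) (h'\<lparr>label := ?i L\<rparr>)" for L
    using iso inv by (auto simp: graph_iso_def)
  have iso2: "graph_iso f (h\<lparr>label := ?j L\<rparr>) (h'\<lparr>label := L\<rparr>)" for L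
    using iso inv by (auto simp: graph_iso_def)
  have iso3: "graph_iso ?f' (h'\<lparr>label := L\<rparr>) (h\<lparr>label := ?j L\<rparr>)" for L
    using graph_iso_sym[OF iso2[of L]] wf by simp
  show ?thesis
    unfolding coefficient_def
  proof (rule sum.reindex_bij_witness[where i = ?j and j = ?i])
    fix L assume L: "L \<in> labelings g h"
    then show "?j (?i L) = L" using inv
      by (auto simp: labelings_def fun_eq_iff extensional_def restrict_def)
    show "?i L \<in> labelings g h'"
      using L graph_iso_trans[OF _ iso1] by (fastforce simp: labelings_def)
    have "(\<Prod>a\<in>vertices h'. representation B (label h' a) (?i L a)) =
        (\<Prod>a\<in>vertices h. representation B (label h' (f a)) (?i L (f a)))"
      by (rule prod.reindex_bij_betw[OF bij, symmetric])
    also have "\<dots> = (\<Prod>a\<in>vertices h. representation B (label h a) (L a))"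
      using iso inv by (intro prod.cong refl) (auto simp: graph_iso_def)
    finally show "(\<Prod>a\<in>vertices h'. representation B (label h' a) (?i L a)) =
       (\<Prod>a\<in>vertices h. representation B (label h a) (L a))" .
  next
    fix L assume L: "L \<in> labelings g h'"
    then show "?i (?j L) = L" using inv
      by (auto simp: labelings_def fun_eq_iff extensional_def restrict_def)
    show "?j L \<in> labelings g h"
      using L graph_iso_trans[OF _ iso3] by (fastforce simp: labelings_def)
  qed
qed

text \<open>
  The label of the vertex \<open>a\<close> enters only through one factor, which is linear in it.
\<close>

lemma coefficient_relabel:
  assumes "finite (vertices h)" "a \<in> vertices h"
  shows "coefficient g (relabel h a u) =
    (\<Sum>L\<in>labelings g h. representation B u (L a) *
       (\<Prod>b\<in>vertices h - {a}. representation B (label h b) (L b)))"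
proof -
  have "labelings g (relabel h a u) = labelings g h" by (simp add: labelings_def relabel_def)
  moreover have "(\<Prod>b\<in>vertices h. representation B (label (relabel h a u) b) (L b)) =
      representation B u (L a) * (\<Prod>b\<in>vertices h - {a}. representation B (label h b) (L b))" for L
    by (subst prod.remove[OF assms]) (auto simp: relabel_def intro!: prod.cong)
  ultimately show ?thesis by (simp add: coefficient_def)
qed

abbreviation coefficient_sum :: "'v lgraph \<Rightarrow> ('v lgraph \<Rightarrow>\<^sub>0 'k) \<Rightarrow> 'k" where
  "coefficient_sum g \<equiv> lincomb (*) (coefficient g)"

lemma coefficient_sum_null:
  assumes "x \<in> graph_null scale"
  shows "coefficient_sum g x = 0"
proof -
  have "coefficient_sum g x \<in> {0}"
  proof (rule linear_span_into[OF eval.linear_axioms _ _ assms[unfolded graph_null_def]])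
    show "module.subspace (*) {0::'k}" by (rule eval.vs2.subspace_single_0)
    fix r assume "r \<in> graph_relations scale"
    then show "coefficient_sum g r \<in> {0}"
    proof (cases rule: graph_relation_cases)
      case (iso h h' f)
      then show ?thesis
        by (simp add: eval.diff eval_single coefficient_iso[OF iso(3) is_graph_wf])
    next
      case (add h a u v)
      have fin: "finite (vertices h)" using add(1) by (simp add: is_graph_iff)
      have "representation B (u + v) b = representation B u b + representation B v b" for b
        by (simp add: representation_add[OF independent_basis] span_basis)
      then have "coefficient g (relabel h a (u + v)) = coefficient g (relabel h a u) + coefficient g (relabel h a v)"
        by (simp only: coefficient_relabel[OF fin add(2)] distrib_right sum.distrib)
      then show ?thesis unfolding add(3)
        by (simp add: eval.diff eval.add eval_single)
    next
      case (scale h a c u)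
      have fin: "finite (vertices h)" using scale(1) by (simp add: is_graph_iff)
      have "representation B (scale c u) b = c * representation B u b" for b
        by (simp add: representation_scale[OF independent_basis] span_basis)
      then have "coefficient g (relabel h a (scale c u)) = c * coefficient g (relabel h a u)"
        by (simp only: coefficient_relabel[OF fin scale(2)] sum_distrib_left mult.assoc)
      then show ?thesis unfolding scale(3)
        by (simp add: eval.diff eval.scale eval_single)
    qed
  qed
  then show ?thesis by simp
qed

text \<open>
  For basis labels the coordinates are Kronecker symbols, so only the given labeling of \<open>h\<close> survives.
\<close>

lemma coefficient_basis_graph:
  assumes "finite (vertices g)" "h \<in> basis_graphs B"
  shows "coefficient g h = (if \<exists>f. graph_iso f g h then 1 else 0)"
proof -
  have fin: "finite (vertices h)" and lab: "\<And>a. a \<in> vertices h \<Longrightarrow> label h a \<in> B"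
    using assms(2) by (auto simp: basis_graphs_def is_graph_iff)
  let ?L = "restrict (label h) (vertices h)"
  have "(\<Prod>a\<in>vertices h. representation B (label h a) (L a)) = (if L = ?L then 1 else 0)"
    if "L \<in> labelings g h" for L
  proof (cases "L = ?L")
    case True
    then show ?thesis using lab by (simp add: representation_basis[OF independent_basis])
  next
    case False
    have "L \<in> extensional (vertices h)" using that by (simp add: labelings_def)
    then have "L = ?L" if "\<forall>a\<in>vertices h. L a = label h a"
      using that by (intro extensionalityI[of L "vertices h"]) simp_all
    with False obtain a where "a \<in> vertices h" "L a \<noteq> label h a" by blast
    then have "\<exists>a\<in>vertices h. representation B (label h a) (L a) = 0"
      using lab by (intro bexI[of _ a]) (simp_all add: representation_basis[OF independent_basis])
    then show ?thesis using False fin by simp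
  qed
  then have "coefficient g h = (\<Sum>L\<in>labelings g h. if L = ?L then 1 else 0)"
    unfolding coefficient_def by (intro sum.cong refl)
  also have "\<dots> = (if ?L \<in> labelings g h then 1 else 0)"
    by (simp add: finite_labelings[OF assms(1)])
  also have "?L \<in> labelings g h \<longleftrightarrow> (\<exists>f. graph_iso f g h)"
  proof -
    have "graph_iso f g (h\<lparr>label := ?L\<rparr>) \<longleftrightarrow> graph_iso f g h" for f
      by (auto simp: graph_iso_def dest: bij_betwE)
    then show ?thesis by (simp add: labelings_def)
  qed
  finally show ?thesis .
qed

text \<open>
  Induction on the number of labels outside the basis. One such label is treated by induction on its
  membership in the span of the basis, using multilinearity at this vertex.
\<close>

lemma expansion_graph:
  assumes "is_graph h"
  shows "\<exists>y. Poly_Mapping.keys y \<subseteq> basis_graphs B \<and> Poly_Mapping.single h 1 - y \<in> graph_null scale"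
  using assms
proof (induction "card {a \<in> vertices h. label h a \<notin> B}" arbitrary: h)
  case 0
  then have "h \<in> basis_graphs B" by (auto simp: basis_graphs_def is_graph_iff)
  then show ?case
    by (intro exI[of _ "Poly_Mapping.single h 1"]) (simp add: pm.subspace_0[OF subspace_graph_null])
next
  case (Suc n)
  have fin: "finite (vertices h)" using Suc.prems by (simp add: is_graph_iff)
  obtain a where a: "a \<in> vertices h" "label h a \<notin> B"
    using Suc.hyps(2) by (metis (mono_tags, lifting) Collect_empty_eq card.empty nat.distinct(1))
  define P where "P u \<longleftrightarrow> (\<exists>y. Poly_Mapping.keys y \<subseteq> basis_graphs B \<and>
    Poly_Mapping.single (relabel h a u) 1 - y \<in> graph_null scale)" for u
  note null = subspace_graph_null[of scale]
  have "P u" for u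
  proof (rule span_induct_alt[of u B P])
    show "u \<in> span B" by (simp add: span_basis)
    \<comment> \<open>A graph with a zero label is itself null, by linearity for the scalar zero.\<close>
    have "Poly_Mapping.single (relabel h a (scale 0 0)) 1 - 0 \<in> graph_null scale"
      using graph_null_scale[OF Suc.prems a(1), of scale 0 0] by simp
    then show "P 0" unfolding P_def by (intro exI[of _ 0]) simp
  next
    fix c b v assume b: "b \<in> B" and "P v"
    then obtain y where y: "Poly_Mapping.keys y \<subseteq> basis_graphs B"
        "Poly_Mapping.single (relabel h a v) 1 - y \<in> graph_null scale"
      by (auto simp: P_def)
    have "{i \<in> vertices h. label h i \<notin> B} = insert a {i \<in> vertices (relabel h a b). label (relabel h a b) i \<notin> B}"
      using a b by (auto simp: relabel_def)
    moreover have "a \<notin> {i \<in> vertices (relabel h a b). label (relabel h a b) i \<notin> B}"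
      using b by (simp add: relabel_def)
    ultimately have "n = card {i \<in> vertices (relabel h a b). label (relabel h a b) i \<notin> B}"
      using Suc.hyps(2) fin by simp
    then obtain z where z: "Poly_Mapping.keys z \<subseteq> basis_graphs B"
        "Poly_Mapping.single (relabel h a b) 1 - z \<in> graph_null scale"
      using Suc.hyps(1)[of "relabel h a b"] Suc.prems by auto
    have "Poly_Mapping.single (relabel h a (scale c b + v)) (1 :: 'k) - (pm_scale c z + y)
      = (Poly_Mapping.single (relabel h a (scale c b + v)) 1
          - (Poly_Mapping.single (relabel h a (scale c b)) 1 + Poly_Mapping.single (relabel h a v) 1))
      + (Poly_Mapping.single (relabel h a (scale c b)) 1 - pm_scale c (Poly_Mapping.single (relabel h a b) 1))
      + pm_scale c (Poly_Mapping.single (relabel h a b) 1 - z)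
      + (Poly_Mapping.single (relabel h a v) 1 - y)"
      by (simp add: pm.scale_right_diff_distrib)
    also have "\<dots> \<in> graph_null scale"
      by (intro pm.subspace_add[OF null] pm.subspace_scale[OF null] y(2) z(2)
          graph_null_add graph_null_scale Suc.prems a(1))
    finally have "Poly_Mapping.single (relabel h a (scale c b + v)) 1 - (pm_scale c z + y) \<in> graph_null scale" .
    moreover have "Poly_Mapping.keys (pm_scale c z + y) \<subseteq> basis_graphs B"
      using Poly_Mapping.keys_add[of "pm_scale c z" y] keys_pm_scale[of c z] y(1) z(1) by blast
    ultimately show "P (scale c b + v)" unfolding P_def by blast
  qed
  from this[of "label h a"] show ?case by (simp add: P_def relabel_def)
qed

lemma expansion:
  assumes "Poly_Mapping.keys x \<subseteq> Collect is_graph"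
  shows "\<exists>y. Poly_Mapping.keys y \<subseteq> basis_graphs B \<and> x - y \<in> graph_null scale"
proof -
  let ?N = "{x. \<exists>y. Poly_Mapping.keys y \<subseteq> basis_graphs B \<and> x - y \<in> graph_null scale}"
  have "?N = {n + y |n y. n \<in> graph_null scale \<and> y \<in> {y. Poly_Mapping.keys y \<subseteq> basis_graphs B}}"
  proof (intro set_eqI iffI)
    fix x assume "x \<in> ?N"
    then obtain y where "Poly_Mapping.keys y \<subseteq> basis_graphs B" "x - y \<in> graph_null scale" by blast
    moreover have "x = (x - y) + y" by simp
    ultimately show "x \<in> {n + y |n y. n \<in> graph_null scale \<and> y \<in> {y. Poly_Mapping.keys y \<subseteq> basis_graphs B}}"
      by blast
  next
    fix x assume "x \<in> {n + y |n y. n \<in> graph_null scale \<and> y \<in> {y. Poly_Mapping.keys y \<subseteq> basis_graphs B}}"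
    then show "x \<in> ?N" by force
  qed
  then have "pm.subspace ?N"
    using pm.subspace_sums[OF subspace_graph_null[of scale] subspace_keys[of "basis_graphs B"]]
    by (simp only:)
  then have "id x \<in> ?N"
    by (rule linear_into_subspace[OF pm.linear_id _ assms]) (simp add: expansion_graph)
  then show ?thesis by simp
qed

text \<open>
  Expansions into basis graphs exist, and on every one of them collecting the coefficients of the graphs isomorphic
  to \<open>g\<close> gives the value of the functional, which depends only on the class. So the definite description is
  well defined.
\<close>

lemma dual_functional_coset:
  assumes "Poly_Mapping.keys x \<subseteq> Collect is_graph" "finite (vertices g)"
  shows "dual_functional B g (coset (graph_null scale) x) = coefficient_sum g x"
proof -
  have collect: "(\<Sum>h\<in>{h \<in> Poly_Mapping.keys y. \<exists>f. graph_iso f g h}. Poly_Mapping.lookup y h) = coefficient_sum g x"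
    if "y - x \<in> graph_null scale" "Poly_Mapping.keys y \<subseteq> basis_graphs B" for y
  proof -
    have "coefficient_sum g x = coefficient_sum g y"
      using coefficient_sum_null[OF that(1), of g] by (simp add: eval.diff)
    also have "\<dots> = (\<Sum>h\<in>Poly_Mapping.keys y. if \<exists>f. graph_iso f g h then Poly_Mapping.lookup y h else 0)"
      unfolding lincomb_def
    proof (intro sum.cong refl)
      fix h assume "h \<in> Poly_Mapping.keys y"
      then have "h \<in> basis_graphs B" using that(2) by blast
      then show "Poly_Mapping.lookup y h * coefficient g h = (if \<exists>f. graph_iso f g h then Poly_Mapping.lookup y h else 0)"
        by (simp add: coefficient_basis_graph[OF assms(2)])
    qed
    finally show ?thesis by (simp add: sum.inter_filter)
  qed
  obtain y where y: "Poly_Mapping.keys y \<subseteq> basis_graphs B" "x - y \<in> graph_null scale"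
    using expansion[OF assms(1)] by blast
  then have "y - x \<in> graph_null scale"
    using pm.subspace_neg[OF subspace_graph_null y(2)] by simp
  with y(1) show ?thesis
    unfolding dual_functional_def coset_def
  proof (intro the_equality)
    assume y: "Poly_Mapping.keys y \<subseteq> basis_graphs B" "y - x \<in> graph_null scale"
    then show "\<exists>z\<in>{y. y - x \<in> graph_null scale}. Poly_Mapping.keys z \<subseteq> basis_graphs B \<and>
        coefficient_sum g x = (\<Sum>h\<in>{h \<in> Poly_Mapping.keys z. \<exists>f. graph_iso f g h}. Poly_Mapping.lookup z h)"
      using collect[OF y(2,1)] by (intro bexI[of _ y] conjI) (simp_all only: mem_Collect_eq)
  next
    fix c
    assume "\<exists>z\<in>{y. y - x \<in> graph_null scale}. Poly_Mapping.keys z \<subseteq> basis_graphs B \<and>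
        c = (\<Sum>h\<in>{h \<in> Poly_Mapping.keys z. \<exists>f. graph_iso f g h}. Poly_Mapping.lookup z h)"
    then obtain z where "z - x \<in> graph_null scale" "Poly_Mapping.keys z \<subseteq> basis_graphs B"
        "c = (\<Sum>h\<in>{h \<in> Poly_Mapping.keys z. \<exists>f. graph_iso f g h}. Poly_Mapping.lookup z h)"
      by (elim bexE conjE) (simp only: mem_Collect_eq)
    then show "c = coefficient_sum g x" by (simp only: collect)
  qed
qed

end


section \<open>Graph polynomials as sums over edge sets\<close>

abbreviation shift_edges :: "nat \<Rightarrow> (nat \<times> nat) set \<Rightarrow> (nat \<times> nat) set" where
  "shift_edges n T \<equiv> map_prod ((+) n) ((+) n) ` T"

text \<open>
  The edges, in both orientations, between the positions of the two halves of a bracket with \<open>m\<close> letters in the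
  left and \<open>n\<close> letters in the right half.
\<close>

definition crossing :: "nat \<Rightarrow> nat \<Rightarrow> (nat \<times> nat) set" where
  "crossing m n = {..<m} \<times> {m..<m + n} \<union> {m..<m + n} \<times> {..<m}"

abbreviation size_letters :: "'v bexp \<Rightarrow> nat" where
  "size_letters e \<equiv> length (letters e)"

text \<open>
  The edge sets on the letter positions that occur in the graph polynomial: one edge
  between the two halves for each subbracket. The positions in the right half are shifted by the size of the left half.
\<close>

primrec bracket_trees :: "'v bexp \<Rightarrow> (nat \<times> nat) set set" where
  "bracket_trees (Letter u) = {{}}"
| "bracket_trees (Bracket a b) =
     (\<lambda>(T, U, d). insert d (T \<union> shift_edges (size_letters a) U)) `
       (bracket_trees a \<times> bracket_trees b \<times> crossing (size_letters a) (size_letters b))"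

definition position_graph :: "'v bexp \<Rightarrow> (nat \<times> nat) set \<Rightarrow> 'v lgraph" where
  "position_graph e T =
     \<lparr>shape = \<lparr>pverts = {..<size_letters e}, parcs = T\<rparr>, label = (\<lambda>i. letters e ! i)\<rparr>"

lemma position_graph_simps [simp]:
  "vertices (position_graph e T) = {..<size_letters e}" "edges (position_graph e T) = T"
  "label (position_graph e T) i = letters e ! i"
  by (simp_all add: position_graph_def)

lemma size_letters_pos: "0 < size_letters e"
  by (induction e) auto

lemma bracket_trees_subset: "T \<in> bracket_trees e \<Longrightarrow> T \<subseteq> {..<size_letters e} \<times> {..<size_letters e}"
proof (induction e arbitrary: T)
  case (Bracket a b)
  then obtain T1 T2 d where "T1 \<in> bracket_trees a" "T2 \<in> bracket_trees b"
      "d \<in> crossing (size_letters a) (size_letters b)" "T = insert d (T1 \<union> shift_edges (size_letters a) T2)"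
    by auto
  with Bracket.IH(1)[of T1] Bracket.IH(2)[of T2] show ?case by (auto simp: crossing_def)
qed simp

lemma finite_bracket_trees: "finite (bracket_trees e)"
  by (induction e) (auto simp: crossing_def)

lemma finite_bracket_trees_edges: "T \<in> bracket_trees e \<Longrightarrow> finite T"
  using bracket_trees_subset finite_subset by blast

lemma bracket_trees_disjoint:
  assumes "T \<in> bracket_trees a" "U \<in> bracket_trees b" "d \<in> crossing (size_letters a) (size_letters b)"
  shows "d \<notin> T" "d \<notin> shift_edges (size_letters a) U" "T \<inter> shift_edges (size_letters a) U = {}"
  using bracket_trees_subset[OF assms(1)] bracket_trees_subset[OF assms(2)] assms(3)
  by (auto simp: crossing_def)

text \<open>
  The three parts can be read off from the edge set, as its edges inside the left half, inside the right half,
  and across.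
\<close>

lemma inj_on_bracket_trees:
  "inj_on (\<lambda>(T, U, d). insert d (T \<union> shift_edges (size_letters a) U))
     (bracket_trees a \<times> bracket_trees b \<times> crossing (size_letters a) (size_letters b))"
proof -
  let ?m = "size_letters a"
  have parts: "T = W \<inter> {..<?m} \<times> {..<?m}" "shift_edges ?m U = W \<inter> {?m..} \<times> {?m..}"
    "{d} = W - {..<?m} \<times> {..<?m} - {?m..} \<times> {?m..}"
    if "T \<in> bracket_trees a" "U \<in> bracket_trees b" "d \<in> crossing ?m (size_letters b)"
      "W = insert d (T \<union> shift_edges ?m U)" for T U d W
    using bracket_trees_subset[OF that(1)] bracket_trees_subset[OF that(2)] that(3,4)
    by (auto simp: crossing_def)
  have inj: "inj (map_prod ((+) ?m) ((+) ?m))" by (auto simp: inj_def)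
  show ?thesis
  proof (rule inj_onI)
    fix p q
    assume p: "p \<in> bracket_trees a \<times> bracket_trees b \<times> crossing ?m (size_letters b)"
      and q: "q \<in> bracket_trees a \<times> bracket_trees b \<times> crossing ?m (size_letters b)"
      and eq: "(case p of (T, U, d) \<Rightarrow> insert d (T \<union> shift_edges ?m U)) =
        (case q of (T, U, d) \<Rightarrow> insert d (T \<union> shift_edges ?m U))"
    obtain T U d where pd: "p = (T, U, d)" by (cases p)
    obtain T' U' d' where qd: "q = (T', U', d')" by (cases q)
    have a: "T \<in> bracket_trees a" "U \<in> bracket_trees b" "d \<in> crossing ?m (size_letters b)"
      "T' \<in> bracket_trees a" "U' \<in> bracket_trees b" "d' \<in> crossing ?m (size_letters b)"
      and eq': "insert d (T \<union> shift_edges ?m U) = insert d' (T' \<union> shift_edges ?m U')"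
      using p q eq by (simp_all add: pd qd)
    note p = parts[OF a(1-3) refl] and p' = parts[OF a(4-6) eq']
    have "T = T'" using p(1) p'(1) by (rule trans[OF _ sym])
    moreover have "shift_edges ?m U = shift_edges ?m U'" using p(2) p'(2) by (rule trans[OF _ sym])
    then have "U = U'" using inj by (simp add: inj_image_eq_iff)
    moreover have "{d} = {d'}" using p(3) p'(3) by (rule trans[OF _ sym])
    ultimately show "p = q" by (simp add: pd qd)
  qed
qed

definition tree_sign :: "(nat \<times> nat) set \<Rightarrow> 'k::field" where
  "tree_sign T = (\<Prod>d\<in>T. sgn_beta id d)"

lemma tree_sign_shift: "tree_sign (shift_edges n U) = tree_sign U"
proof -
  have "inj_on (map_prod ((+) n) ((+) n)) U" by (auto simp: inj_on_def)
  then show ?thesis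
    unfolding tree_sign_def
    by (subst prod.reindex) (auto simp: sgn_beta_def intro!: prod.cong)
qed

lemma tree_sign_insert:
  assumes "T \<in> bracket_trees a" "U \<in> bracket_trees b" "d \<in> crossing (size_letters a) (size_letters b)"
  shows "tree_sign (insert d (T \<union> shift_edges (size_letters a) U)) =
    sgn_beta id d * (tree_sign T * tree_sign U)"
proof -
  have "tree_sign (insert d (T \<union> shift_edges (size_letters a) U)) =
      sgn_beta id d * (tree_sign T * tree_sign (shift_edges (size_letters a) U))"
    unfolding tree_sign_def
    using bracket_trees_disjoint[OF assms] finite_bracket_trees_edges[OF assms(1)] finite_bracket_trees_edges[OF assms(2)]
    by (subst prod.insert; simp add: prod.union_disjoint)
  then show ?thesis by (simp add: tree_sign_shift)
qed

lemma sum_crossing: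
  fixes F :: "nat \<times> nat \<Rightarrow> 'a::comm_monoid_add"
  shows "(\<Sum>d\<in>crossing m n. F d) = (\<Sum>i<m. \<Sum>j<n. F (i, m + j) + F (m + j, i))"
proof -
  have "(\<Sum>d\<in>crossing m n. F d) = (\<Sum>d\<in>{..<m} \<times> {m..<m + n}. F d) + (\<Sum>d\<in>{m..<m + n} \<times> {..<m}. F d)"
    unfolding crossing_def by (rule sum.union_disjoint) auto
  also have "(\<Sum>d\<in>{..<m} \<times> {m..<m + n}. F d) = (\<Sum>i<m. \<Sum>j\<in>{m..<m + n}. F (i, j))"
    by (simp add: sum.cartesian_product)
  also have "(\<Sum>d\<in>{m..<m + n} \<times> {..<m}. F d) = (\<Sum>j\<in>{m..<m + n}. \<Sum>i<m. F (j, i))"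
    by (simp add: sum.cartesian_product)
  also have "\<dots> = (\<Sum>i<m. \<Sum>j\<in>{m..<m + n}. F (j, i))" by (rule sum.swap)
  finally have "(\<Sum>d\<in>crossing m n. F d) =
    (\<Sum>i<m. \<Sum>j\<in>{m..<m + n}. F (i, j)) + (\<Sum>i<m. \<Sum>j\<in>{m..<m + n}. F (j, i))" .
  moreover have "(\<Sum>j\<in>{m..<m + n}. G j) = (\<Sum>j<n. G (m + j))" for G :: "nat \<Rightarrow> 'a"
    using sum.shift_bounds_nat_ivl[of G 0 m n] by (simp add: atLeast0LessThan add.commute)
  ultimately show ?thesis by (simp only: sum.distrib)
qed

lemma sum_bracket_trees_bracket:
  "(\<Sum>W\<in>bracket_trees (Bracket a b). F W) =
     (\<Sum>T\<in>bracket_trees a. \<Sum>U\<in>bracket_trees b. \<Sum>d\<in>crossing (size_letters a) (size_letters b).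
        F (insert d (T \<union> shift_edges (size_letters a) U)))"
  unfolding bracket_trees.simps sum.reindex[OF inj_on_bracket_trees]
  by (simp add: sum.cartesian_product case_prod_beta)

lemma lessThan_Un_shift: "{..<m} \<union> (+) m ` {..<n} = {..<m + n}" for m n :: nat
proof -
  have "(+) m ` {..<n} = {m..<m + n}"
    by (simp add: lessThan_atLeast0 add.commute)
  then show ?thesis by auto
qed

text \<open>
  A join numbers the vertices alternately, a graph on positions numbers them consecutively. The map \<open>f\<close>
  translates the first numbering into the second one.
\<close>

lemma position_graph_join_left:
  "\<exists>f. graph_iso f (join (position_graph a T) (position_graph b U) i j)
    (position_graph (Bracket a b) (insert (i, size_letters a + j) (T \<union> shift_edges (size_letters a) U)))"
proof -
  let ?m = "size_letters a"
  define f where "f k = (if even k then k div 2 else ?m + k div 2)" for k :: nat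
  have f: "f (2 * k) = k" "f (Suc (2 * k)) = ?m + k" for k by (simp_all add: f_def)
  have fo: "f \<circ> (\<lambda>i. 2 * i) = id" "f \<circ> (\<lambda>i. 2 * i + 1) = (+) ?m" by (simp_all add: f fun_eq_iff)
  have "inj_on f ((\<lambda>i. 2 * i) ` {..<?m} \<union> (\<lambda>i. 2 * i + 1) ` {..<size_letters b})"
    by (auto simp: inj_on_def f)
  moreover have "f ` ((\<lambda>i. 2 * i) ` {..<?m} \<union> (\<lambda>i. 2 * i + 1) ` {..<size_letters b}) = {..<?m + size_letters b}"
    by (simp add: image_Un image_image f lessThan_Un_shift Un_commute)
  ultimately have bij: "bij_betw f (vertices (join (position_graph a T) (position_graph b U) i j))
      {..<?m + size_letters b}"
    by (simp only: bij_betw_def vertices_join position_graph_simps)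
  have edges: "insert (i, ?m + j) (T \<union> shift_edges ?m U) =
      map_prod f f ` edges (join (position_graph a T) (position_graph b U) i j)"
    unfolding edges_join position_graph_simps image_Un image_comp map_prod.comp fo map_prod.id image_id
    by (auto simp: f)
  have "graph_iso f (join (position_graph a T) (position_graph b U) i j)
    (position_graph (Bracket a b) (insert (i, ?m + j) (T \<union> shift_edges ?m U)))"
    unfolding graph_iso_def
  proof (intro conjI ballI)
    fix k assume "k \<in> vertices (join (position_graph a T) (position_graph b U) i j)"
    then show "label (position_graph (Bracket a b) (insert (i, ?m + j) (T \<union> shift_edges ?m U))) (f k) =
        label (join (position_graph a T) (position_graph b U) i j) k"
      by (auto simp: f join_def nth_append)
  qed (use bij edges in simp_all)
  then show ?thesis by blast
qed

lemma position_graph_join_right: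
  "\<exists>f. graph_iso f (join (position_graph b U) (position_graph a T) j i)
    (position_graph (Bracket a b) (insert (size_letters a + j, i) (T \<union> shift_edges (size_letters a) U)))"
proof -
  let ?m = "size_letters a"
  define f where "f k = (if odd k then k div 2 else ?m + k div 2)" for k :: nat
  have f: "f (Suc (2 * k)) = k" "f (2 * k) = ?m + k" for k by (simp_all add: f_def)
  have fo: "f \<circ> (\<lambda>i. 2 * i + 1) = id" "f \<circ> (\<lambda>i. 2 * i) = (+) ?m" by (simp_all add: f fun_eq_iff)
  have "inj_on f ((\<lambda>i. 2 * i) ` {..<size_letters b} \<union> (\<lambda>i. 2 * i + 1) ` {..<?m})"
    by (auto simp: inj_on_def f)
  moreover have "f ` ((\<lambda>i. 2 * i) ` {..<size_letters b} \<union> (\<lambda>i. 2 * i + 1) ` {..<?m}) = {..<?m + size_letters b}"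
    by (simp add: image_Un image_image f lessThan_Un_shift Un_commute)
  ultimately have bij: "bij_betw f (vertices (join (position_graph b U) (position_graph a T) j i))
      {..<?m + size_letters b}"
    by (simp only: bij_betw_def vertices_join position_graph_simps)
  have edges: "insert (?m + j, i) (T \<union> shift_edges ?m U) =
      map_prod f f ` edges (join (position_graph b U) (position_graph a T) j i)"
    unfolding edges_join position_graph_simps image_Un image_comp map_prod.comp fo map_prod.id image_id
    by (auto simp: f)
  have "graph_iso f (join (position_graph b U) (position_graph a T) j i)
    (position_graph (Bracket a b) (insert (?m + j, i) (T \<union> shift_edges ?m U)))"
    unfolding graph_iso_def
  proof (intro conjI ballI)
    fix k assume "k \<in> vertices (join (position_graph b U) (position_graph a T) j i)"
    then show "label (position_graph (Bracket a b) (insert (?m + j, i) (T \<union> shift_edges ?m U))) (f k) =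
        label (join (position_graph b U) (position_graph a T) j i) k"
      by (auto simp: f join_def nth_append)
  qed (use bij edges in simp_all)
  then show ?thesis by blast
qed

lemma lincomb_cong:
  "(\<And>a. a \<in> Poly_Mapping.keys x \<Longrightarrow> f a = g a) \<Longrightarrow> lincomb s f x = lincomb s g x"
  by (simp add: lincomb_def)

text \<open>
  The commutator of two graphs is the sum over all new edges in both orientations, with opposite signs. Being an
  identity of bilinear maps, this extends to linear combinations.
\<close>

lemma eval_commutator:
  fixes F :: "'v lgraph \<Rightarrow> 'k::field"
  shows "lincomb (*) F (commutator x y) =
    lincomb (*) (\<lambda>g. lincomb (*) (\<lambda>h. \<Sum>i\<in>vertices g. \<Sum>j\<in>vertices h. F (join g h i j) - F (join h g j i)) y) x"
    (is "?L x y = ?R x y")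
proof -
  have 1: "Vector_Spaces.linear pm_scale (*) (\<lambda>x. ?L x y)" for y
    by (intro linearI vector_space_pm_scale vector_space_field; simp only: commutator_bilinear eval.add eval.scale)
  have 2: "Vector_Spaces.linear pm_scale (*) (\<lambda>y. ?L x y)" for x
    by (intro linearI vector_space_pm_scale vector_space_field; simp only: commutator_bilinear eval.add eval.scale)
  have 3: "Vector_Spaces.linear pm_scale (*) (\<lambda>x. ?R x y)" for y
    by (rule eval.linear_axioms)
  have 4: "Vector_Spaces.linear pm_scale (*) (\<lambda>y. ?R (Poly_Mapping.single g 1) y)" for g
    unfolding eval_single mult_1 by (rule eval.linear_axioms)
  show ?thesis
  proof (rule linear_ext[OF 1 3], rule linear_ext[OF 2 4])
    fix g h :: "'v lgraph"
    have "(\<Sum>j\<in>vertices h. \<Sum>i\<in>vertices g. F (join h g j i)) = (\<Sum>i\<in>vertices g. \<Sum>j\<in>vertices h. F (join h g j i))"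
      by (rule sum.swap)
    then show "?L (Poly_Mapping.single g 1) (Poly_Mapping.single h 1) = ?R (Poly_Mapping.single g 1) (Poly_Mapping.single h 1)"
      by (simp add: commutator_def graph_prod_single eval_single eval.diff eval.sum sum_subtractf)
  qed
qed

lemma wf_join:
  "wf_graph g \<Longrightarrow> wf_graph h \<Longrightarrow> i \<in> vertices g \<Longrightarrow> j \<in> vertices h \<Longrightarrow> wf_graph (join g h i j)"
  by (auto simp: join_def)

lemma wf_position_graph: "T \<in> bracket_trees e \<Longrightarrow> wf_graph (position_graph e T)"
  using bracket_trees_subset by simp

text \<open>
  The graph polynomial as a signed sum over \<^const>\<open>bracket_trees\<close>, stated for the values of a functional that
  is invariant under isomorphism. With functionals in place of congruences modulo relations, the induction can
  absorb each factor of a commutator into the functional: as a function of the left graph alone, the value on the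
  commutator with the right factor is again invariant.
\<close>

lemma eval_graph_poly:
  fixes F :: "'v lgraph \<Rightarrow> 'k::field"
  assumes "\<And>f g h. graph_iso f g h \<Longrightarrow> wf_graph g \<Longrightarrow> F g = F h"
  shows "lincomb (*) F (graph_poly e) = (\<Sum>T\<in>bracket_trees e. tree_sign T * F (position_graph e T))"
  using assms
proof (induction e arbitrary: F)
  case (Letter u)
  have "graph_iso id (point u) (position_graph (Letter u) {})"
    by (auto simp: graph_iso_def point_def position_graph_def bij_betw_def lessThan_Suc)
  then have "F (point u) = F (position_graph (Letter u) {})" by (rule Letter) (simp add: point_def)
  then show ?case by (simp add: eval_single tree_sign_def)
next
  case (Bracket a b)
  \<comment> \<open>The value of \<open>F\<close> on the commutator of two single graphs; it is invariant in both arguments.\<close>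
  define H where "H g h = (\<Sum>i\<in>vertices g. \<Sum>j\<in>vertices h. F (join g h i j) - F (join h g j i))" for g h
  have H_iso: "H g h = H g' h'"
    if "graph_iso f g g'" "graph_iso f' h h'" "wf_graph g" "wf_graph h" for f f' g g' h h'
  proof -
    have bij: "bij_betw f (vertices g) (vertices g')" "bij_betw f' (vertices h) (vertices h')"
      using that(1,2) by (auto simp: graph_iso_def)
    have "H g h = (\<Sum>i\<in>vertices g. \<Sum>j\<in>vertices h. F (join g' h' (f i) (f' j)) - F (join h' g' (f' j) (f i)))"
      unfolding H_def
    proof (intro sum.cong refl arg_cong2[where f = "(-)"])
      fix i j assume ij: "i \<in> vertices g" "j \<in> vertices h"
      show "F (join g h i j) = F (join g' h' (f i) (f' j))"
        by (rule Bracket.prems[OF graph_iso_join[OF that(1,2)] wf_join[OF that(3,4) ij]])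
      show "F (join h g j i) = F (join h' g' (f' j) (f i))"
        by (rule Bracket.prems[OF graph_iso_join[OF that(2,1)] wf_join[OF that(4,3) ij(2,1)]])
    qed
    also have "\<dots> = H g' h'"
      unfolding H_def sum.reindex_bij_betw[OF bij(1), of "\<lambda>i. \<Sum>j\<in>vertices h'. F (join g' h' i j) - F (join h' g' j i)", symmetric]
      by (intro sum.cong refl sum.reindex_bij_betw[OF bij(2)])
    finally show ?thesis .
  qed
  have "lincomb (*) F (graph_poly (Bracket a b)) = lincomb (*) (\<lambda>g. lincomb (*) (H g) (graph_poly b)) (graph_poly a)"
    using eval_commutator[of F "graph_poly a" "graph_poly b"] by (simp add: commutator_def H_def[abs_def])
  also have "\<dots> = (\<Sum>T\<in>bracket_trees a. tree_sign T * lincomb (*) (H (position_graph a T)) (graph_poly b))"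
  proof (rule Bracket.IH(1))
    fix f and g h :: "'v lgraph" assume "graph_iso f g h" "wf_graph g"
    then show "lincomb (*) (H g) (graph_poly b) = lincomb (*) (H h) (graph_poly b)"
      using keys_graph_poly[of b] H_iso[OF _ graph_iso_id] is_graph_wf
      by (intro lincomb_cong) blast
  qed
  also have "\<dots> = (\<Sum>T\<in>bracket_trees a. tree_sign T * (\<Sum>U\<in>bracket_trees b. tree_sign U * H (position_graph a T) (position_graph b U)))"
  proof (intro sum.cong refl arg_cong2[where f = "(*)"] Bracket.IH(2))
    fix T f and g h :: "'v lgraph" assume "T \<in> bracket_trees a" "graph_iso f g h" "wf_graph g"
    then show "H (position_graph a T) g = H (position_graph a T) h"
      using H_iso[OF graph_iso_id] wf_position_graph by blast
  qed
  also have "\<dots> = (\<Sum>T\<in>bracket_trees a. \<Sum>U\<in>bracket_trees b. \<Sum>d\<in>crossing (size_letters a) (size_letters b).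
     tree_sign (insert d (T \<union> shift_edges (size_letters a) U)) *
     F (position_graph (Bracket a b) (insert d (T \<union> shift_edges (size_letters a) U))))"
    unfolding sum_distrib_left
  proof (intro sum.cong refl)
    fix T U assume TU: "T \<in> bracket_trees a" "U \<in> bracket_trees b"
    let ?m = "size_letters a" and ?n = "size_letters b"
    let ?W = "\<lambda>d. insert d (T \<union> shift_edges ?m U)"
    let ?P = "\<lambda>d. F (position_graph (Bracket a b) (?W d))"
    have H: "H (position_graph a T) (position_graph b U) = (\<Sum>i<?m. \<Sum>j<?n. ?P (i, ?m + j) - ?P (?m + j, i))"
      unfolding H_def position_graph_simps
    proof (intro sum.cong refl arg_cong2[where f = "(-)"])
      fix i j assume ij: "i \<in> {..<?m}" "j \<in> {..<?n}"
      obtain f f' where "graph_iso f (join (position_graph a T) (position_graph b U) i j)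
          (position_graph (Bracket a b) (?W (i, ?m + j)))"
        and "graph_iso f' (join (position_graph b U) (position_graph a T) j i)
          (position_graph (Bracket a b) (?W (?m + j, i)))"
        using position_graph_join_left position_graph_join_right by meson
      moreover have "wf_graph (join (position_graph a T) (position_graph b U) i j)"
        "wf_graph (join (position_graph b U) (position_graph a T) j i)"
        using ij by (intro wf_join wf_position_graph TU; simp)+
      ultimately show "F (join (position_graph a T) (position_graph b U) i j) = ?P (i, ?m + j)"
        "F (join (position_graph b U) (position_graph a T) j i) = ?P (?m + j, i)"
        using Bracket.prems by metis+
    qed
    have sg: "sgn_beta id (i, ?m + j) = (1 :: 'k)" "sgn_beta id (?m + j, i) = (-1 :: 'k)" if "i < ?m" for i j
      using that by (auto simp: sgn_beta_def)
    have "H (position_graph a T) (position_graph b U) = (\<Sum>d\<in>crossing ?m ?n. sgn_beta id d * ?P d)"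
      unfolding sum_crossing H by (intro sum.cong refl) (simp add: sg)
    then have "tree_sign T * (tree_sign U * H (position_graph a T) (position_graph b U)) =
      (\<Sum>d\<in>crossing ?m ?n. tree_sign T * (tree_sign U * (sgn_beta id d * ?P d)))"
      by (simp only: sum_distrib_left)
    also have "\<dots> = (\<Sum>d\<in>crossing ?m ?n. tree_sign (?W d) * ?P d)"
    proof (rule sum.cong[OF refl])
      fix d assume "d \<in> crossing ?m ?n"
      then have "tree_sign (?W d) = sgn_beta id d * (tree_sign T * tree_sign U :: 'k)"
        by (rule tree_sign_insert[OF TU])
      then show "tree_sign T * (tree_sign U * (sgn_beta id d * ?P d)) = tree_sign (?W d) * ?P d"
        by (simp only: mult_ac)
    qed
    finally show "tree_sign T * (tree_sign U * H (position_graph a T) (position_graph b U)) =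
      (\<Sum>d\<in>crossing ?m ?n. tree_sign (?W d) * ?P d)" .
  qed
  also have "\<dots> = (\<Sum>W\<in>bracket_trees (Bracket a b). tree_sign W * F (position_graph (Bracket a b) W))"
    by (rule sum_bracket_trees_bracket[symmetric])
  finally show ?case .
qed


section \<open>Edge sets in bijection with the subbrackets\<close>

lemma subbrackets_subset: "S \<in> subbrackets e \<Longrightarrow> S \<subseteq> {..<size_letters e}"
proof (induction e arbitrary: S)
  case (Bracket a b)
  from Bracket.prems consider "S = {..<size_letters a + size_letters b}" | "S \<in> subbrackets a"
    | S' where "S' \<in> subbrackets b" "S = (+) (size_letters a) ` S'" by auto
  then show ?case
  proof cases
    case 2
    then show ?thesis using Bracket.IH(1)[of S] by auto
  next
    case 3
    then show ?thesis using Bracket.IH(2)[of S'] by auto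
  qed auto
qed simp

lemma subbrackets_nonempty: "S \<in> subbrackets e \<Longrightarrow> S \<noteq> {}"
proof (induction e arbitrary: S)
  case (Bracket a b)
  then show ?case using size_letters_pos[of a] by auto
qed simp

text \<open>
  The property that defines \<^const>\<open>beta\<close> as a least element.
\<close>

definition smallest_subbracket :: "'v bexp \<Rightarrow> nat \<Rightarrow> nat \<Rightarrow> nat set \<Rightarrow> bool" where
  "smallest_subbracket e i j S \<longleftrightarrow> S \<in> subbrackets e \<and> i \<in> S \<and> j \<in> S \<and>
     (\<forall>S'\<in>subbrackets e. i \<in> S' \<longrightarrow> j \<in> S' \<longrightarrow> S \<subseteq> S')"

lemma beta_eqI: "smallest_subbracket e i j S \<Longrightarrow> beta e id (i, j) = S"
  unfolding beta_def smallest_subbracket_def prod.case id_apply by (rule Least_equality) blast+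

lemma subbrackets_bracket_cases [consumes 1, case_names whole left right]:
  assumes "S \<in> subbrackets (Bracket a b)"
  obtains "S = {..<size_letters a + size_letters b}" | "S \<in> subbrackets a"
    | S' where "S' \<in> subbrackets b" "S = (+) (size_letters a) ` S'"
  using assms by auto

lemma smallest_subbracket_left:
  assumes "smallest_subbracket a i j S"
  shows "smallest_subbracket (Bracket a b) i j S"
  unfolding smallest_subbracket_def
proof (intro conjI ballI impI)
  have sub: "S \<subseteq> {..<size_letters a}" using assms subbrackets_subset unfolding smallest_subbracket_def by blast
  show "S \<in> subbrackets (Bracket a b)" "i \<in> S" "j \<in> S"
    using assms by (simp_all add: smallest_subbracket_def)
  fix S' assume S': "S' \<in> subbrackets (Bracket a b)" "i \<in> S'" "j \<in> S'"
  from S'(1) show "S \<subseteq> S'"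
  proof (cases rule: subbrackets_bracket_cases)
    case whole
    then show ?thesis using sub by auto
  next
    case left
    then show ?thesis using assms S' by (simp add: smallest_subbracket_def)
  next
    case (right S'')
    then show ?thesis using S'(2) sub \<open>i \<in> S\<close> by auto
  qed
qed

lemma smallest_subbracket_right:
  assumes "smallest_subbracket b i j S"
  shows "smallest_subbracket (Bracket a b) (size_letters a + i) (size_letters a + j) ((+) (size_letters a) ` S)"
  unfolding smallest_subbracket_def
proof (intro conjI ballI impI)
  let ?m = "size_letters a"
  have sub: "S \<subseteq> {..<size_letters b}" using assms subbrackets_subset unfolding smallest_subbracket_def by blast
  show "(+) ?m ` S \<in> subbrackets (Bracket a b)" "?m + i \<in> (+) ?m ` S" "?m + j \<in> (+) ?m ` S"
    using assms by (simp_all add: smallest_subbracket_def)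
  fix S' assume S': "S' \<in> subbrackets (Bracket a b)" "?m + i \<in> S'" "?m + j \<in> S'"
  from S'(1) show "(+) ?m ` S \<subseteq> S'"
  proof (cases rule: subbrackets_bracket_cases)
    case whole
    then show ?thesis using sub by auto
  next
    case left
    then have "?m + i \<in> {..<?m}" using S'(2) subbrackets_subset by blast
    then show ?thesis by simp
  next
    case (right S'')
    then have "i \<in> S''" "j \<in> S''" using S'(2,3) by auto
    then have "S \<subseteq> S''" using assms right(1) by (simp add: smallest_subbracket_def)
    then show ?thesis using right(2) by blast
  qed
qed

lemma smallest_subbracket_crossing:
  assumes "(i, j) \<in> crossing (size_letters a) (size_letters b)"
  shows "smallest_subbracket (Bracket a b) i j {..<size_letters a + size_letters b}"
  unfolding smallest_subbracket_def
proof (intro conjI ballI impI)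
  let ?m = "size_letters a" and ?n = "size_letters b"
  show "{..<?m + ?n} \<in> subbrackets (Bracket a b)" "i \<in> {..<?m + ?n}" "j \<in> {..<?m + ?n}"
    using assms by (auto simp: crossing_def)
  fix S' assume S': "S' \<in> subbrackets (Bracket a b)" "i \<in> S'" "j \<in> S'"
  from S'(1) show "{..<?m + ?n} \<subseteq> S'"
  proof (cases rule: subbrackets_bracket_cases)
    case left
    then have "i < ?m" "j < ?m" using S'(2,3) subbrackets_subset by blast+
    then show ?thesis using assms by (simp add: crossing_def)
  next
    case (right S'')
    then have "?m \<le> i" "?m \<le> j" using S'(2,3) by auto
    then show ?thesis using assms by (simp add: crossing_def)
  qed simp
qed

lemma pair_cases_bracket:
  fixes i j m n :: nat
  assumes "i < m + n" "j < m + n"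
  obtains "i < m" "j < m" | i' j' where "i = m + i'" "j = m + j'" "i' < n" "j' < n"
    | "(i, j) \<in> crossing m n"
proof (cases "i < m"; cases "j < m")
  assume "\<not> i < m" "\<not> j < m"
  then show thesis using assms that(2)[of "i - m" "j - m"] by auto
qed (use assms that in \<open>auto simp: crossing_def\<close>)

text \<open>
  Going down from the whole expression, the positions \<open>i\<close> and \<open>j\<close> are separated at exactly one bracket.
\<close>

lemma smallest_subbracket_exists:
  assumes "i < size_letters e" "j < size_letters e" "i \<noteq> j"
  shows "\<exists>S. smallest_subbracket e i j S"
  using assms
proof (induction e arbitrary: i j)
  case (Bracket a b)
  have "i < size_letters a + size_letters b" "j < size_letters a + size_letters b"
    using Bracket.prems by auto
  then show ?case
  proof (cases rule: pair_cases_bracket)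
    case 1
    then show ?thesis using Bracket.IH(1) Bracket.prems(3) smallest_subbracket_left by blast
  next
    case (2 i' j')
    then show ?thesis using Bracket.IH(2)[of i' j'] Bracket.prems(3) smallest_subbracket_right by blast
  next
    case 3
    then show ?thesis using smallest_subbracket_crossing by blast
  qed
qed simp

lemma beta_smallest:
  assumes "i < size_letters e" "j < size_letters e" "i \<noteq> j"
  shows "smallest_subbracket e i j (beta e id (i, j))"
  using smallest_subbracket_exists[OF assms] beta_eqI by metis

text \<open>
  A map that respects a partition of the target is bijective iff it is so on every part.
\<close>

lemma bij_betw_Un_iff:
  assumes "f ` A \<subseteq> A'" "f ` C \<subseteq> C'" "A' \<inter> C' = {}"
  shows "bij_betw f (A \<union> C) (A' \<union> C') \<longleftrightarrow> bij_betw f A A' \<and> bij_betw f C C'"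
proof
  assume bij: "bij_betw f (A \<union> C) (A' \<union> C')"
  then have "f ` A \<union> f ` C = A' \<union> C'" by (simp add: bij_betw_def image_Un)
  then have "f ` A = A'" "f ` C = C'" using assms by blast+
  then show "bij_betw f A A' \<and> bij_betw f C C'"
    using bij by (auto simp: bij_betw_def intro: inj_on_subset)
next
  assume "bij_betw f A A' \<and> bij_betw f C C'"
  then show "bij_betw f (A \<union> C) (A' \<union> C')" using bij_betw_combine assms(3) by blast
qed

text \<open>
  Loops have to be excluded explicitly: a single position usually lies in a smallest subbracket too, so
  bijectivity of \<^const>\<open>beta\<close> would not rule them out.
\<close>

definition proper_pairs :: "'v bexp \<Rightarrow> (nat \<times> nat) set" where
  "proper_pairs e = {(i, j). i < size_letters e \<and> j < size_letters e \<and> i \<noteq> j}"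

lemma proper_pairs_bracket:
  "proper_pairs (Bracket a b) = proper_pairs a \<union> shift_edges (size_letters a) (proper_pairs b)
     \<union> crossing (size_letters a) (size_letters b)"
proof (intro set_eqI iffI)
  fix p assume "p \<in> proper_pairs (Bracket a b)"
  then obtain i j where p: "p = (i, j)" "i < size_letters a + size_letters b" "j < size_letters a + size_letters b" "i \<noteq> j"
    by (auto simp: proper_pairs_def)
  from p(2,3) show "p \<in> proper_pairs a \<union> shift_edges (size_letters a) (proper_pairs b) \<union> crossing (size_letters a) (size_letters b)"
    by (cases rule: pair_cases_bracket) (use p in \<open>auto simp: proper_pairs_def\<close>)
qed (auto simp: proper_pairs_def crossing_def)

lemma beta_in_subbrackets: "d \<in> proper_pairs e \<Longrightarrow> beta e id d \<in> subbrackets e"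
  using beta_smallest by (auto simp: proper_pairs_def smallest_subbracket_def)

lemma beta_left:
  assumes "d \<in> proper_pairs a"
  shows "beta (Bracket a b) id d = beta a id d"
proof -
  obtain i j where d: "d = (i, j)" "i < size_letters a" "j < size_letters a" "i \<noteq> j"
    using assms by (auto simp: proper_pairs_def)
  show ?thesis
    unfolding d(1) by (rule beta_eqI[OF smallest_subbracket_left[OF beta_smallest[OF d(2-4)]]])
qed

lemma beta_right:
  assumes "d \<in> proper_pairs b"
  shows "beta (Bracket a b) id (map_prod ((+) (size_letters a)) ((+) (size_letters a)) d) =
     (+) (size_letters a) ` beta b id d"
proof -
  obtain i j where d: "d = (i, j)" "i < size_letters b" "j < size_letters b" "i \<noteq> j"
    using assms by (auto simp: proper_pairs_def)
  show ?thesis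
    unfolding d(1) map_prod_simp
    by (rule beta_eqI[OF smallest_subbracket_right[OF beta_smallest[OF d(2-4)]]])
qed

lemma beta_crossing:
  "d \<in> crossing (size_letters a) (size_letters b) \<Longrightarrow>
     beta (Bracket a b) id d = {..<size_letters a + size_letters b}"
  using beta_eqI[OF smallest_subbracket_crossing] by (cases d) blast

text \<open>
  Edges inside the left or right half are sent to subbrackets of that half, and crossing edges to the whole bracket,
  which is hit exactly once iff there is one crossing edge.
\<close>

lemma bij_betw_beta_bracket:
  assumes T: "T \<subseteq> proper_pairs a" and U: "U \<subseteq> proper_pairs b"
    and D: "D \<subseteq> crossing (size_letters a) (size_letters b)"
  shows "bij_betw (beta (Bracket a b) id) (T \<union> shift_edges (size_letters a) U \<union> D) (subbrackets (Bracket a b)) \<longleftrightarrow>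
    bij_betw (beta a id) T (subbrackets a) \<and> bij_betw (beta b id) U (subbrackets b) \<and> (\<exists>d. D = {d})"
proof -
  let ?m = "size_letters a" and ?n = "size_letters b" and ?\<beta> = "beta (Bracket a b) id"
  let ?s = "\<lambda>U. shift_edges ?m U" and ?full = "{..<?m + ?n}"
  have full: "S \<noteq> ?full" if "S \<in> subbrackets a" for S
    using subbrackets_subset[OF that] size_letters_pos[of b] by (auto simp: subset_iff)
  have full': "(+) ?m ` S \<noteq> ?full" for S
    using size_letters_pos[of a] by (metis UnCI add_is_0 imageE lessThan_iff not_gr_zero trans_less_add1)
  have disj: "S \<noteq> (+) ?m ` S'" if "S \<in> subbrackets a" for S S'
    using subbrackets_subset[OF that] subbrackets_nonempty[OF that] by auto
  have "subbrackets (Bracket a b) = (subbrackets a \<union> (`) ((+) ?m) ` subbrackets b) \<union> {?full}" by auto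
  moreover have "?\<beta> ` T \<subseteq> subbrackets a"
  proof (intro image_subsetI)
    fix d assume "d \<in> T"
    then have "d \<in> proper_pairs a" using T by blast
    then show "?\<beta> d \<in> subbrackets a" by (simp only: beta_left beta_in_subbrackets)
  qed
  moreover have "?\<beta> ` ?s U \<subseteq> (`) ((+) ?m) ` subbrackets b"
  proof (intro image_subsetI)
    fix d assume "d \<in> ?s U"
    then obtain d' where d': "d' \<in> U" "d = map_prod ((+) ?m) ((+) ?m) d'" by (elim imageE) simp
    then have "d' \<in> proper_pairs b" using U by blast
    then show "?\<beta> d \<in> (`) ((+) ?m) ` subbrackets b"
      unfolding d'(2) by (simp only: beta_right beta_in_subbrackets imageI)
  qed
  moreover have image_D: "?\<beta> ` D \<subseteq> {?full}" using D beta_crossing by blast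
  moreover have "subbrackets a \<inter> (`) ((+) ?m) ` subbrackets b = {}" using disj by blast
  moreover have "(subbrackets a \<union> (`) ((+) ?m) ` subbrackets b) \<inter> {?full} = {}" using full full' by blast
  ultimately have "bij_betw ?\<beta> (T \<union> ?s U \<union> D) (subbrackets (Bracket a b)) \<longleftrightarrow>
      (bij_betw ?\<beta> T (subbrackets a) \<and> bij_betw ?\<beta> (?s U) ((`) ((+) ?m) ` subbrackets b)) \<and> bij_betw ?\<beta> D {?full}"
    by (simp only: bij_betw_Un_iff image_Un Un_mono)
  also have "bij_betw ?\<beta> T (subbrackets a) \<longleftrightarrow> bij_betw (beta a id) T (subbrackets a)"
  proof (rule bij_betw_cong)
    fix d assume "d \<in> T"
    then have "d \<in> proper_pairs a" using T by blast
    then show "?\<beta> d = beta a id d" by (rule beta_left)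
  qed
  also have "bij_betw ?\<beta> (?s U) ((`) ((+) ?m) ` subbrackets b) \<longleftrightarrow> bij_betw (beta b id) U (subbrackets b)"
  proof -
    have inj: "inj_on (map_prod ((+) ?m) ((+) ?m)) U" by (auto simp: inj_on_def)
    have inj': "inj (\<lambda>S. (+) ?m ` S)" by (auto simp: inj_def inj_image_eq_iff)
    have eq: "(?\<beta> \<circ> map_prod ((+) ?m) ((+) ?m)) d = ((\<lambda>S. (+) ?m ` S) \<circ> beta b id) d" if "d \<in> U" for d
      
    proof -
      have "d \<in> proper_pairs b" using that U by blast
      then show ?thesis by (simp only: o_apply beta_right)
    qed
    have "bij_betw ?\<beta> (?s U) ((`) ((+) ?m) ` subbrackets b) \<longleftrightarrow>
        bij_betw (?\<beta> \<circ> map_prod ((+) ?m) ((+) ?m)) U ((`) ((+) ?m) ` subbrackets b)"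
      using inj by (simp add: bij_betw_comp_iff[OF inj_on_imp_bij_betw])
    also have "\<dots> \<longleftrightarrow> bij_betw ((\<lambda>S. (+) ?m ` S) \<circ> beta b id) U ((`) ((+) ?m) ` subbrackets b)"
      by (rule bij_betw_cong) (rule eq)
    also have "\<dots> \<longleftrightarrow> bij_betw (beta b id) U (subbrackets b)"
    proof -
      have "(((\<lambda>S. (+) ?m ` S) \<circ> beta b id) ` U = (`) ((+) ?m) ` subbrackets b) \<longleftrightarrow> beta b id ` U = subbrackets b"
        unfolding image_comp[symmetric] by (rule inj_image_eq_iff[OF inj'])
      moreover have "inj_on ((\<lambda>S. (+) ?m ` S) \<circ> beta b id) U \<longleftrightarrow> inj_on (beta b id) U"
      proof
        assume "inj_on ((\<lambda>S. (+) ?m ` S) \<circ> beta b id) U"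
        then show "inj_on (beta b id) U" by (rule inj_on_imageI2)
      next
        assume "inj_on (beta b id) U"
        then show "inj_on ((\<lambda>S. (+) ?m ` S) \<circ> beta b id) U"
          by (rule comp_inj_on) (rule inj_on_subset[OF inj' subset_UNIV])
      qed
      ultimately show ?thesis by (simp only: bij_betw_def)
    qed
    finally show ?thesis .
  qed
  also have "bij_betw ?\<beta> D {?full} \<longleftrightarrow> (\<exists>d. D = {d})"
  proof
    assume bij: "bij_betw ?\<beta> D {?full}"
    then show "\<exists>d. D = {d}" by (metis bij_betw_same_card card_1_singletonE is_singletonI is_singleton_altdef)
  next
    assume "\<exists>d. D = {d}"
    then show "bij_betw ?\<beta> D {?full}" using image_D by (auto simp: bij_betw_def)
  qed
  finally show ?thesis by blast
qed

text \<open>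
  This links the recursive description of the edge sets in a graph polynomial with the bijectivity
  required of $\beta_\sigma$.
\<close>

lemma bracket_trees_iff:
  "W \<in> bracket_trees e \<longleftrightarrow> W \<subseteq> proper_pairs e \<and> bij_betw (beta e id) W (subbrackets e)"
proof (induction e arbitrary: W)
  case (Letter u)
  then show ?case by (auto simp: proper_pairs_def bij_betw_def)
next
  case (Bracket a b)
  let ?m = "size_letters a" and ?n = "size_letters b"
  show ?case
  proof
    assume "W \<in> bracket_trees (Bracket a b)"
    then obtain T U d where W: "W = T \<union> shift_edges ?m U \<union> {d}" "T \<in> bracket_trees a" "U \<in> bracket_trees b" "d \<in> crossing ?m ?n"
      by auto
    then have TU: "T \<subseteq> proper_pairs a" "bij_betw (beta a id) T (subbrackets a)"
        "U \<subseteq> proper_pairs b" "bij_betw (beta b id) U (subbrackets b)"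
      using Bracket.IH by blast+
    have "bij_betw (beta (Bracket a b) id) W (subbrackets (Bracket a b))"
      unfolding W(1) by (subst bij_betw_beta_bracket) (use TU W(4) in auto)
    moreover have "W \<subseteq> proper_pairs (Bracket a b)"
      unfolding W(1) proper_pairs_bracket using TU(1,3) W(4) by blast
    ultimately show "W \<subseteq> proper_pairs (Bracket a b) \<and> bij_betw (beta (Bracket a b) id) W (subbrackets (Bracket a b))"
      by blast
  next
    assume W: "W \<subseteq> proper_pairs (Bracket a b) \<and> bij_betw (beta (Bracket a b) id) W (subbrackets (Bracket a b))"
    define T where "T = W \<inter> proper_pairs a"
    define U where "U = map_prod ((+) ?m) ((+) ?m) -` W \<inter> proper_pairs b"
    define D where "D = W \<inter> crossing ?m ?n"
    have "shift_edges ?m U = W \<inter> shift_edges ?m (proper_pairs b)" by (auto simp: U_def)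
    then have eq: "W = T \<union> shift_edges ?m U \<union> D"
      using W unfolding proper_pairs_bracket T_def D_def by blast
    have sub: "T \<subseteq> proper_pairs a" "U \<subseteq> proper_pairs b" "D \<subseteq> crossing ?m ?n"
      by (auto simp: T_def U_def D_def)
    from W have "bij_betw (beta a id) T (subbrackets a)" "bij_betw (beta b id) U (subbrackets b)" "\<exists>d. D = {d}"
      unfolding eq using bij_betw_beta_bracket[OF sub] by blast+
    then obtain d where "T \<in> bracket_trees a" "U \<in> bracket_trees b" "D = {d}" using Bracket.IH sub by blast
    moreover then have "W = insert d (T \<union> shift_edges ?m U)" "d \<in> crossing ?m ?n" using eq sub(3) by auto
    ultimately show "W \<in> bracket_trees (Bracket a b)" by (auto intro!: image_eqI[of _ _ "(T, U, d)"])
  qed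
qed


section \<open>Transporting a graph to the letter positions\<close>

text \<open>
  All bijections between vertices and positions. The condition on coordinates in \<^const>\<open>bijections\<close> only
  discards summands of weight zero, and transport along a bijection makes sense without it.
\<close>

definition placements :: "'v lgraph \<Rightarrow> 'v bexp \<Rightarrow> (nat \<Rightarrow> nat) set" where
  "placements g e = {\<sigma> \<in> extensional (vertices g). bij_betw \<sigma> (vertices g) {..<size_letters e}}"

text \<open>
  The edges and labels of \<open>g\<close>, carried over to the letter positions along \<open>\<sigma>\<close>.
\<close>

definition transport :: "'v lgraph \<Rightarrow> 'v bexp \<Rightarrow> (nat \<Rightarrow> nat) \<Rightarrow> (nat \<times> nat) set \<times> (nat \<Rightarrow> 'v)" where
  "transport g e \<sigma> =
     (map_prod \<sigma> \<sigma> ` edges g, restrict (label g \<circ> inv_into (vertices g) \<sigma>) {..<size_letters e})"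

abbreviation transported_graph :: "'v bexp \<Rightarrow> (nat \<times> nat) set \<times> (nat \<Rightarrow> 'v) \<Rightarrow> 'v lgraph" where
  "transported_graph e p \<equiv> position_graph e (fst p)\<lparr>label := snd p\<rparr>"

lemma graph_iso_transport:
  assumes "\<sigma> \<in> placements g e"
  shows "graph_iso \<sigma> g (transported_graph e (transport g e \<sigma>))"
proof -
  have bij: "bij_betw \<sigma> (vertices g) {..<size_letters e}" using assms by (simp add: placements_def)
  have "snd (transport g e \<sigma>) (\<sigma> a) = label g a" if "a \<in> vertices g" for a
  proof -
    have "\<sigma> a \<in> {..<size_letters e}" using bij that by (rule bij_betw_apply)
    then show ?thesis using bij_betw_inv_into_left[OF bij that] by (simp add: transport_def)
  qed
  then show ?thesis using bij by (simp add: graph_iso_def transport_def)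
qed

text \<open>
  Conversely to the previous lemma, the transported edges and labels are the only ones for which \<open>\<sigma>\<close> is
  an isomorphism.
\<close>

lemma transport_eqI:
  assumes "\<sigma> \<in> placements g e" "graph_iso \<sigma> g (transported_graph e p)"
    and "snd p \<in> extensional {..<size_letters e}"
  shows "transport g e \<sigma> = p"
proof -
  have bij: "bij_betw \<sigma> (vertices g) {..<size_letters e}" using assms(1) by (simp add: placements_def)
  have "fst (transport g e \<sigma>) = fst p" using assms(2) by (simp add: graph_iso_def transport_def)
  moreover have "snd (transport g e \<sigma>) = snd p"
  proof (rule extensionalityI[OF _ assms(3)])
    show "snd (transport g e \<sigma>) \<in> extensional {..<size_letters e}" by (simp add: transport_def)
    fix i assume i: "i \<in> {..<size_letters e}"
    have a: "inv_into (vertices g) \<sigma> i \<in> vertices g"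
      using bij_betw_inv_into[OF bij] i by (rule bij_betw_apply)
    have "snd (transport g e \<sigma>) i = label g (inv_into (vertices g) \<sigma> i)" using i by (simp add: transport_def)
    also have "\<dots> = snd p (\<sigma> (inv_into (vertices g) \<sigma> i))"
      using assms(2) a by (simp add: graph_iso_def)
    also have "\<dots> = snd p i" using bij_betw_inv_into_right[OF bij i] by simp
    finally show "snd (transport g e \<sigma>) i = snd p i" .
  qed
  ultimately show ?thesis by (rule prod_eqI)
qed

lemma graph_iso_cong:
  assumes "graph_iso f g h" "wf_graph g" "\<And>a. a \<in> vertices g \<Longrightarrow> f' a = f a"
  shows "graph_iso f' g h"
proof -
  have "map_prod f' f' ` edges g = map_prod f f ` edges g"
    using assms(2,3) by (intro image_cong refl) (auto simp: subset_iff)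
  moreover have "bij_betw f' (vertices g) (vertices h) \<longleftrightarrow> bij_betw f (vertices g) (vertices h)"
    by (rule bij_betw_cong) (rule assms(3))
  ultimately show ?thesis using assms(1,3) by (simp add: graph_iso_def)
qed

text \<open>
  If \<open>\<sigma>\<close> and \<open>\<tau>\<close> are isomorphisms from \<open>g\<close> onto the same graph, then \<open>\<tau>\<close> followed by the inverse of \<open>\<sigma>\<close> is an
  automorphism of \<open>g\<close>; conversely an isomorphism composed with an automorphism is an isomorphism onto the same graph.
\<close>

lemma transport_eq_iff:
  assumes wf: "wf_graph g" and \<sigma>: "\<sigma> \<in> placements g e" and \<tau>: "\<tau> \<in> placements g e"
  shows "transport g e \<sigma> = transport g e \<tau> \<longleftrightarrow> (\<exists>\<alpha>\<in>automorphisms g. \<forall>a\<in>vertices g. \<tau> a = \<sigma> (\<alpha> a))"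
proof
  let ?V = "vertices g"
  assume eq: "transport g e \<sigma> = transport g e \<tau>"
  have bij: "bij_betw \<sigma> ?V {..<size_letters e}" "bij_betw \<tau> ?V {..<size_letters e}"
    using \<sigma> \<tau> by (auto simp: placements_def)
  define \<alpha> where "\<alpha> = restrict (inv_into ?V \<sigma> \<circ> \<tau>) ?V"
  have "graph_iso (inv_into ?V \<sigma> \<circ> \<tau>) g g"
    using graph_iso_trans[OF graph_iso_transport[OF \<tau>] graph_iso_sym[OF graph_iso_transport[OF \<sigma>] wf, unfolded eq]] .
  then have "graph_iso \<alpha> g g" by (rule graph_iso_cong[OF _ wf]) (simp add: \<alpha>_def)
  then have "\<alpha> \<in> automorphisms g" by (simp add: automorphisms_def \<alpha>_def)
  moreover have "\<tau> a = \<sigma> (\<alpha> a)" if "a \<in> ?V" for a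
    using bij_betw_inv_into_right[OF bij(1) bij_betw_apply[OF bij(2) that]] that by (simp add: \<alpha>_def)
  ultimately show "\<exists>\<alpha>\<in>automorphisms g. \<forall>a\<in>?V. \<tau> a = \<sigma> (\<alpha> a)" by blast
next
  assume "\<exists>\<alpha>\<in>automorphisms g. \<forall>a\<in>vertices g. \<tau> a = \<sigma> (\<alpha> a)"
  then obtain \<alpha> where \<alpha>: "graph_iso \<alpha> g g" "\<And>a. a \<in> vertices g \<Longrightarrow> \<tau> a = (\<sigma> \<circ> \<alpha>) a"
    by (auto simp: automorphisms_def)
  have "graph_iso \<tau> g (transported_graph e (transport g e \<sigma>))"
    by (rule graph_iso_cong[OF graph_iso_trans[OF \<alpha>(1) graph_iso_transport[OF \<sigma>]] wf \<alpha>(2)])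
  then have "transport g e \<tau> = transport g e \<sigma>"
    by (rule transport_eqI[OF \<tau>]) (simp add: transport_def)
  then show "transport g e \<sigma> = transport g e \<tau>" by simp
qed

lemma fst_transport_bracket_tree_iff:
  assumes "is_graph g" "\<sigma> \<in> placements g e"
  shows "fst (transport g e \<sigma>) \<in> bracket_trees e \<longleftrightarrow> bij_betw (beta e \<sigma>) (edges g) (subbrackets e)"
proof -
  have bij: "bij_betw \<sigma> (vertices g) {..<size_letters e}" using assms by (simp add: placements_def)
  have E: "edges g \<subseteq> vertices g \<times> vertices g" "\<And>a b. (a, b) \<in> edges g \<Longrightarrow> (b, a) \<notin> edges g"
    using assms(1) by (auto simp: is_graph_iff)
  have inj: "inj_on (map_prod \<sigma> \<sigma>) (edges g)"
    using bij E(1) by (intro inj_on_subset[OF map_prod_inj_on]) (auto simp: bij_betw_def)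
  have "map_prod \<sigma> \<sigma> ` edges g \<subseteq> proper_pairs e"
  proof
    fix d assume "d \<in> map_prod \<sigma> \<sigma> ` edges g"
    then obtain a b where d: "d = (\<sigma> a, \<sigma> b)" "(a, b) \<in> edges g" by auto
    then have "a \<in> vertices g" "b \<in> vertices g" "a \<noteq> b" using E by blast+
    then have "\<sigma> a < size_letters e" "\<sigma> b < size_letters e" "\<sigma> a \<noteq> \<sigma> b"
      using bij by (auto simp: bij_betw_def inj_on_def)
    then show "d \<in> proper_pairs e" by (simp add: d proper_pairs_def)
  qed
  moreover have "bij_betw (beta e id) (map_prod \<sigma> \<sigma> ` edges g) (subbrackets e) \<longleftrightarrow>
      bij_betw (beta e id \<circ> map_prod \<sigma> \<sigma>) (edges g) (subbrackets e)"
    using bij_betw_comp_iff[OF inj_on_imp_bij_betw[OF inj]] by blast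
  moreover have "beta e id \<circ> map_prod \<sigma> \<sigma> = beta e \<sigma>" by (auto simp: beta_def)
  ultimately show ?thesis by (simp add: bracket_trees_iff transport_def)
qed

lemma tree_sign_transport:
  assumes "is_graph g" "\<sigma> \<in> placements g e"
  shows "tree_sign (fst (transport g e \<sigma>)) = (\<Prod>d\<in>edges g. sgn_beta \<sigma> d :: 'k::field)"
proof -
  have "inj_on \<sigma> (vertices g)" "edges g \<subseteq> vertices g \<times> vertices g"
    using assms by (auto simp: placements_def bij_betw_def is_graph_iff)
  then have "inj_on (map_prod \<sigma> \<sigma>) (edges g)"
    by (intro inj_on_subset[OF map_prod_inj_on]) auto
  moreover have "sgn_beta id \<circ> map_prod \<sigma> \<sigma> = (sgn_beta \<sigma> :: _ \<Rightarrow> 'k)" by (auto simp: sgn_beta_def)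
  ultimately show ?thesis by (simp only: tree_sign_def transport_def fst_conv prod.reindex)
qed

lemma finite_placements:
  assumes "is_graph g"
  shows "finite (placements g e)"
proof -
  have "placements g e \<subseteq> vertices g \<rightarrow>\<^sub>E {..<size_letters e}"
    by (auto simp: placements_def PiE_def dest: bij_betwE)
  moreover have "finite (vertices g)" using assms by (simp add: is_graph_iff)
  ultimately show ?thesis by (meson finite_PiE finite_lessThan finite_subset)
qed


section \<open>Summing over bijections\<close>

context based_space
begin

definition label_product :: "'v bexp \<Rightarrow> (nat \<Rightarrow> 'v) \<Rightarrow> 'k" where
  "label_product e L = (\<Prod>i<size_letters e. representation B (letters e ! i) (L i))"

text \<open>
  The contribution of a pair to the coefficient of \<open>g\<close> in the graph polynomial. The value zero on other
  edge sets matches the value of \<^const>\<open>pairing_at\<close> when \<^const>\<open>beta\<close> is not bijective.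
\<close>

definition transport_value :: "'v bexp \<Rightarrow> (nat \<times> nat) set \<times> (nat \<Rightarrow> 'v) \<Rightarrow> 'k" where
  "transport_value e p = (if fst p \<in> bracket_trees e then tree_sign (fst p) * label_product e (snd p) else 0)"

text \<open>
  The pairs of an admissible edge set and a labeling of the positions that make up a graph isomorphic
  to \<open>g\<close>.
\<close>

definition transport_pairs :: "'v lgraph \<Rightarrow> 'v bexp \<Rightarrow> ((nat \<times> nat) set \<times> (nat \<Rightarrow> 'v)) set" where
  "transport_pairs g e = Sigma (bracket_trees e) (\<lambda>T. labelings g (position_graph e T))"

lemma coefficient_sum_graph_poly:
  assumes "is_graph g"
  shows "coefficient_sum g (graph_poly e) = (\<Sum>p\<in>transport_pairs g e. transport_value e p)"
proof -
  have fin: "finite (labelings g (position_graph e T))" for T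
    using assms by (intro finite_labelings) (simp add: is_graph_iff)
  have "coefficient_sum g (graph_poly e) =
      (\<Sum>T\<in>bracket_trees e. tree_sign T * coefficient g (position_graph e T))"
    by (rule eval_graph_poly) (rule coefficient_iso)
  also have "\<dots> = (\<Sum>T\<in>bracket_trees e. \<Sum>L\<in>labelings g (position_graph e T). transport_value e (T, L))"
    by (intro sum.cong refl)
       (simp add: coefficient_def transport_value_def label_product_def sum_distrib_left)
  also have "\<dots> = (\<Sum>p\<in>transport_pairs g e. transport_value e p)"
    unfolding transport_pairs_def by (subst sum.Sigma) (simp_all add: finite_bracket_trees fin)
  finally show ?thesis .
qed

lemma label_product_transport:
  assumes "\<sigma> \<in> placements g e"
  shows "label_product e (snd (transport g e \<sigma>)) = weight scale B g e \<sigma>"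
proof -
  have bij: "bij_betw \<sigma> (vertices g) {..<size_letters e}" using assms by (simp add: placements_def)
  have "label_product e (snd (transport g e \<sigma>)) =
      (\<Prod>a\<in>vertices g. representation B (letters e ! \<sigma> a) (snd (transport g e \<sigma>) (\<sigma> a)))"
    unfolding label_product_def by (rule prod.reindex_bij_betw[OF bij, symmetric])
  also have "\<dots> = weight scale B g e \<sigma>"
    unfolding weight_def using graph_iso_transport[OF assms]
    by (intro prod.cong refl) (simp add: graph_iso_def)
  finally show ?thesis .
qed

lemma pairing_at_eq_transport_value:
  assumes "is_graph g" "\<sigma> \<in> placements g e"
  shows "pairing_at scale B g e \<sigma> = transport_value e (transport g e \<sigma>)"
proof -
  have "tree_sign (fst (transport g e \<sigma>)) = (\<Prod>d\<in>edges g. sgn_beta \<sigma> d :: 'k)"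
    by (rule tree_sign_transport[OF assms])
  then show ?thesis
    using fst_transport_bracket_tree_iff[OF assms] label_product_transport[OF assms(2)]
    by (simp add: pairing_at_def transport_value_def mult.commute)
qed

lemma bijections_eq: "bijections scale B g e =
    {\<sigma> \<in> placements g e. \<forall>a\<in>vertices g. representation B (letters e ! \<sigma> a) (label g a) \<noteq> 0}"
  by (auto simp: bijections_def placements_def)

lemma transport_in_pairs:
  assumes "\<sigma> \<in> placements g e" "fst (transport g e \<sigma>) \<in> bracket_trees e"
  shows "transport g e \<sigma> \<in> transport_pairs g e"
proof -
  have "snd (transport g e \<sigma>) \<in> labelings g (position_graph e (fst (transport g e \<sigma>)))"
    unfolding labelings_def using graph_iso_transport[OF assms(1)]
    by (auto simp: transport_def)
  then show ?thesis using assms(2) by (simp add: transport_pairs_def mem_Sigma_iff split_beta mem_Times_iff)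
     (metis mem_Sigma_iff prod.collapse)
qed

text \<open>
  An isomorphism from \<open>g\<close> onto the graph given by the pair is a bijection that transports \<open>g\<close> to it. The condition that all
  coordinates are nonzero is automatic for pairs with nonzero contribution.
\<close>

lemma transport_pairs_obtain:
  assumes "is_graph g" "p \<in> transport_pairs g e" "transport_value e p \<noteq> 0"
  obtains \<sigma> where "\<sigma> \<in> bijections scale B g e" "transport g e \<sigma> = p"
proof -
  obtain f where T: "fst p \<in> bracket_trees e" and L: "snd p \<in> extensional {..<size_letters e}"
    and f: "graph_iso f g (transported_graph e p)"
    using assms(2) by (auto simp: transport_pairs_def labelings_def)
  define \<sigma> where "\<sigma> = restrict f (vertices g)"
  have iso: "graph_iso \<sigma> g (transported_graph e p)"
    by (rule graph_iso_cong[OF f is_graph_wf[OF assms(1)]]) (simp add: \<sigma>_def)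
  then have \<sigma>: "\<sigma> \<in> placements g e" by (simp add: placements_def graph_iso_def \<sigma>_def)
  have eq: "transport g e \<sigma> = p" by (rule transport_eqI[OF \<sigma> iso L])
  have "weight scale B g e \<sigma> \<noteq> 0"
    using assms(3) T label_product_transport[OF \<sigma>] by (auto simp: eq transport_value_def)
  moreover have "finite (vertices g)" using assms(1) by (simp add: is_graph_iff)
  ultimately have "\<sigma> \<in> bijections scale B g e"
    using \<sigma> by (auto simp: bijections_eq weight_def)
  then show thesis using eq that by blast
qed

text \<open>
  The two index sets differ only by pairs with zero contribution: transports whose edge set is not
  admissible, and pairs for which some coordinate vanishes.
\<close>

lemma sum_transport_values:
  assumes "is_graph g"
  shows "(\<Sum>p\<in>transport g e ` bijections scale B g e. transport_value e p) =
    (\<Sum>p\<in>transport_pairs g e. transport_value e p)"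
proof -
  let ?I = "transport g e ` bijections scale B g e" and ?P = "transport_pairs g e"
  have "finite ?I"
    using finite_placements[OF assms, of e] by (intro finite_imageI) (simp add: bijections_eq)
  moreover have "transport_value e p = 0" if "p \<in> ?I - ?P" for p
    using that transport_in_pairs by (auto simp: bijections_eq transport_value_def)
  ultimately have "(\<Sum>p\<in>?I. transport_value e p) = (\<Sum>p\<in>?I \<inter> ?P. transport_value e p)"
    by (intro sum.mono_neutral_right) auto
  also have "\<dots> = (\<Sum>p\<in>?P. transport_value e p)"
  proof (rule sum.mono_neutral_left)
    show "finite ?P"
      unfolding transport_pairs_def using assms
      by (intro finite_SigmaI finite_bracket_trees finite_labelings) (simp add: is_graph_iff)
    show "\<forall>p\<in>?P - ?I \<inter> ?P. transport_value e p = 0"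
    proof (intro ballI, rule ccontr)
      fix p assume p: "p \<in> ?P - ?I \<inter> ?P" "transport_value e p \<noteq> 0"
      then obtain \<sigma> where "\<sigma> \<in> bijections scale B g e" "transport g e \<sigma> = p"
        using transport_pairs_obtain[OF assms, of p e] by blast
      then show False using p(1) by blast
    qed
  qed simp
  finally show ?thesis .
qed

text \<open>
  These fibers of \<^const>\<open>transport\<close> are the classes of bijections.
\<close>

definition fiber :: "'v lgraph \<Rightarrow> 'v bexp \<Rightarrow> (nat \<times> nat) set \<times> (nat \<Rightarrow> 'v) \<Rightarrow> (nat \<Rightarrow> nat) set" where
  "fiber g e p = {\<tau> \<in> bijections scale B g e. transport g e \<tau> = p}"

lemma bijection_classes_eq:
  assumes "is_graph g"
  shows "bijection_classes scale B g e = fiber g e ` transport g e ` bijections scale B g e"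
proof -
  have "bijection_equiv scale B g e =
      {(\<sigma>, \<tau>). \<sigma> \<in> bijections scale B g e \<and> \<tau> \<in> bijections scale B g e \<and> transport g e \<tau> = transport g e \<sigma>}"
    unfolding bijection_equiv_def
    using transport_eq_iff[OF is_graph_wf[OF assms]] by (auto simp: bijections_eq) metis+
  then have "bijection_equiv scale B g e `` {\<sigma>} = fiber g e (transport g e \<sigma>)"
    if "\<sigma> \<in> bijections scale B g e" for \<sigma>
    using that by (auto simp: fiber_def)
  then show ?thesis
    unfolding bijection_classes_def quotient_def image_image by (auto simp: image_iff)
qed

lemma pairing_at_class_fiber:
  assumes "is_graph g" "p \<in> transport g e ` bijections scale B g e"
  shows "pairing_at_class scale B g e (fiber g e p) = transport_value e p"
proof -
  have "pairing_at scale B g e \<sigma> = transport_value e p" if "\<sigma> \<in> fiber g e p" for \<sigma>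
    using that pairing_at_eq_transport_value[OF assms(1)] by (auto simp: fiber_def bijections_eq)
  moreover have "fiber g e p \<noteq> {}" using assms(2) by (auto simp: fiber_def)
  ultimately have "pairing_at scale B g e ` fiber g e p = {transport_value e p}" by force
  then show ?thesis by (simp add: pairing_at_class_def)
qed

text \<open>
  The automorphisms of \<open>g\<close> act on a fiber by composition, freely because bijections are injective and
  transitively by \<open>transport_eq_iff\<close>.
\<close>

lemma card_fiber:
  assumes "is_graph g" "p \<in> transport g e ` bijections scale B g e"
  shows "card (fiber g e p) = card (automorphisms g)"
proof -
  let ?V = "vertices g"
  obtain \<sigma> where \<sigma>: "\<sigma> \<in> bijections scale B g e" and p: "p = transport g e \<sigma>" using assms(2) by blast
  then have \<sigma>': "\<sigma> \<in> placements g e" by (simp add: bijections_eq)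
  then have bij: "bij_betw \<sigma> ?V {..<size_letters e}" by (simp add: placements_def)
  note wf = is_graph_wf[OF assms(1)]
  have "bij_betw (\<lambda>\<alpha>. restrict (\<sigma> \<circ> \<alpha>) ?V) (automorphisms g) (fiber g e p)"
  proof (rule bij_betw_imageI)
    show "inj_on (\<lambda>\<alpha>. restrict (\<sigma> \<circ> \<alpha>) ?V) (automorphisms g)"
    proof (rule inj_onI)
      fix \<alpha> \<beta> assume \<alpha>: "\<alpha> \<in> automorphisms g" and \<beta>: "\<beta> \<in> automorphisms g"
        and eq: "restrict (\<sigma> \<circ> \<alpha>) ?V = restrict (\<sigma> \<circ> \<beta>) ?V"
      have ext: "\<alpha> \<in> extensional ?V" "\<beta> \<in> extensional ?V"
        and bij': "bij_betw \<alpha> ?V ?V" "bij_betw \<beta> ?V ?V"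
        using \<alpha> \<beta> by (auto simp: automorphisms_def graph_iso_def)
      show "\<alpha> = \<beta>"
      proof (rule extensionalityI[OF ext])
        fix a assume a: "a \<in> ?V"
        have "\<sigma> (\<alpha> a) = \<sigma> (\<beta> a)" using fun_cong[OF eq, of a] a by simp
        then show "\<alpha> a = \<beta> a"
          using bij bij_betw_apply[OF bij'(1) a] bij_betw_apply[OF bij'(2) a]
          by (auto simp: bij_betw_def inj_on_def)
      qed
    qed
    show "(\<lambda>\<alpha>. restrict (\<sigma> \<circ> \<alpha>) ?V) ` automorphisms g = fiber g e p"
    proof (intro set_eqI iffI)
      fix \<tau> assume "\<tau> \<in> (\<lambda>\<alpha>. restrict (\<sigma> \<circ> \<alpha>) ?V) ` automorphisms g"
      then obtain \<alpha> where \<alpha>: "\<alpha> \<in> automorphisms g" and \<tau>: "\<tau> = restrict (\<sigma> \<circ> \<alpha>) ?V" by blast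
      have \<alpha>': "bij_betw \<alpha> ?V ?V" "\<And>a. a \<in> ?V \<Longrightarrow> label g (\<alpha> a) = label g a"
        using \<alpha> by (auto simp: automorphisms_def graph_iso_def)
      have "bij_betw \<tau> ?V {..<size_letters e}"
        unfolding \<tau> using bij_betw_trans[OF \<alpha>'(1) bij] by (simp cong: bij_betw_cong)
      then have "\<tau> \<in> placements g e" by (simp add: placements_def \<tau>)
      moreover from this have "transport g e \<sigma> = transport g e \<tau>"
        using transport_eq_iff[OF wf \<sigma>'] \<alpha> by (auto simp: \<tau>)
      moreover have "representation B (letters e ! \<tau> a) (label g a) \<noteq> 0" if "a \<in> ?V" for a
      proof -
        have "representation B (letters e ! \<sigma> (\<alpha> a)) (label g (\<alpha> a)) \<noteq> 0"
          using \<sigma> bij_betw_apply[OF \<alpha>'(1) that] by (simp add: bijections_eq)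
        then show ?thesis using that by (simp add: \<tau> \<alpha>'(2))
      qed
      ultimately show "\<tau> \<in> fiber g e p" by (simp add: fiber_def p bijections_eq)
    next
      fix \<tau> assume "\<tau> \<in> fiber g e p"
      then have \<tau>: "\<tau> \<in> placements g e" "transport g e \<sigma> = transport g e \<tau>"
        by (auto simp: fiber_def p bijections_eq)
      then obtain \<alpha> where \<alpha>: "\<alpha> \<in> automorphisms g" "\<forall>a\<in>?V. \<tau> a = \<sigma> (\<alpha> a)"
        using transport_eq_iff[OF wf \<sigma>'] by blast
      have "\<tau> = restrict (\<sigma> \<circ> \<alpha>) ?V"
        using \<tau>(1) \<alpha>(2) by (intro extensionalityI[of \<tau> ?V]) (simp_all add: placements_def)
      then show "\<tau> \<in> (\<lambda>\<alpha>. restrict (\<sigma> \<circ> \<alpha>) ?V) ` automorphisms g" using \<alpha>(1) by blast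
    qed
  qed
  then show ?thesis by (metis bij_betw_same_card)
qed

lemma sum_pairing_at_class:
  assumes "is_graph g"
  shows "(\<Sum>C\<in>bijection_classes scale B g e. pairing_at_class scale B g e C) =
    (\<Sum>p\<in>transport g e ` bijections scale B g e. transport_value e p)"
proof -
  have "inj_on (fiber g e) (transport g e ` bijections scale B g e)"
  proof (rule inj_onI)
    fix p q assume "p \<in> transport g e ` bijections scale B g e" and eq: "fiber g e p = fiber g e q"
    then obtain \<sigma> where "\<sigma> \<in> fiber g e p" by (auto simp: fiber_def)
    moreover from this have "\<sigma> \<in> fiber g e q" by (simp only: eq)
    ultimately show "p = q" by (simp add: fiber_def)
  qed
  then have "(\<Sum>C\<in>bijection_classes scale B g e. pairing_at_class scale B g e C) =
      (\<Sum>p\<in>transport g e ` bijections scale B g e. pairing_at_class scale B g e (fiber g e p))"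
    by (simp only: bijection_classes_eq[OF assms] sum.reindex o_def)
  also have "\<dots> = (\<Sum>p\<in>transport g e ` bijections scale B g e. transport_value e p)"
    by (rule sum.cong[OF refl]) (rule pairing_at_class_fiber[OF assms])
  finally show ?thesis .
qed

lemma sum_pairing_at:
  assumes "is_graph g"
  shows "(\<Sum>\<sigma>\<in>bijections scale B g e. pairing_at scale B g e \<sigma>) =
    of_nat (card (automorphisms g)) * (\<Sum>p\<in>transport g e ` bijections scale B g e. transport_value e p)"
proof -
  have fin: "finite (bijections scale B g e)"
    using finite_placements[OF assms, of e] by (simp add: bijections_eq)
  have "(\<Sum>\<sigma>\<in>bijections scale B g e. pairing_at scale B g e \<sigma>) =
      (\<Sum>\<sigma>\<in>bijections scale B g e. transport_value e (transport g e \<sigma>))"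
    by (intro sum.cong refl pairing_at_eq_transport_value[OF assms]) (simp add: bijections_eq)
  also have "\<dots> = (\<Sum>p\<in>transport g e ` bijections scale B g e. \<Sum>\<sigma>\<in>fiber g e p. transport_value e (transport g e \<sigma>))"
    unfolding fiber_def by (rule sum.image_gen[OF fin])
  also have "\<dots> = (\<Sum>p\<in>transport g e ` bijections scale B g e. of_nat (card (automorphisms g)) * transport_value e p)"
  proof (rule sum.cong[OF refl])
    fix p assume p: "p \<in> transport g e ` bijections scale B g e"
    have "(\<Sum>\<sigma>\<in>fiber g e p. transport_value e (transport g e \<sigma>)) = (\<Sum>\<sigma>\<in>fiber g e p. transport_value e p)"
      by (rule sum.cong[OF refl]) (simp add: fiber_def)
    then show "(\<Sum>\<sigma>\<in>fiber g e p. transport_value e (transport g e \<sigma>)) =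
        of_nat (card (automorphisms g)) * transport_value e p"
      by (simp add: card_fiber[OF assms p])
  qed
  finally show ?thesis by (simp only: sum_distrib_left)
qed

lemma pairing_dual_functional:
  assumes "is_graph g"
  shows "pairing scale (dual_functional B g) (lie_elt scale e) =
    (\<Sum>p\<in>transport g e ` bijections scale B g e. transport_value e p)"
proof -
  have "finite (vertices g)" using assms by (simp add: is_graph_iff)
  then show ?thesis
    unfolding pairing_def p_G_lie_elt sum_transport_values[OF assms] coefficient_sum_graph_poly[OF assms, symmetric]
    by (rule dual_functional_coset[OF keys_graph_poly])
qed

end

theorem proposition3p11:
  fixes scale :: "'k::field \<Rightarrow> 'v::ab_group_add \<Rightarrow> 'v"
    and B :: "'v set" and g :: "'v lgraph" and e :: "'v bexp"
  assumes "vector_space scale"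
    and "\<not> module.dependent scale B" and "module.span scale B = UNIV"
    and "is_graph g" and "label g ` vertices g \<subseteq> B"
  shows "pairing scale (dual_functional B g) (lie_elt scale e)
           = (\<Sum>C\<in>bijection_classes scale B g e. pairing_at_class scale B g e C) \<and>
         of_nat (card (automorphisms g)) * pairing scale (dual_functional B g) (lie_elt scale e)
           = (\<Sum>\<sigma>\<in>bijections scale B g e. pairing_at scale B g e \<sigma>) \<and>
         (bijections scale B g e = {} \<longrightarrow>
           pairing scale (dual_functional B g) (lie_elt scale e) = 0)"
proof -
  interpret based_space scale B
    using assms(1-3) by (simp add: based_space_def based_space_axioms_def)
  show ?thesis
    by (simp add: pairing_dual_functional[OF assms(4)] sum_pairing_at_class[OF assms(4)]
        sum_pairing_at[OF assms(4)])
qed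

end
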